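(* Let $\Sigma$ be a valid signature, let $\mathcal V$ be a finite collection of arithmetic variables, $\mathcal C$ an arithmetic proposition over $\mathcal V$, and let $A,B$ be types with $\mathcal V;\mathcal C\vdash_\Sigma A\ \mathit{valid}$ and $\mathcal V;\mathcal C\vdash_\Sigma B\ \mathit{valid}$. If the algorithmic type equality judgment $\mathcal V\,;\,\mathcal C\,;\,\cdot\,\vdash A\equiv B$ (with empty collection of closures) is derivable, then $\forall\mathcal V.\,\mathcal C\Rightarrow A\equiv B$; that is, there exists a type bisimulation $\mathcal R$ such that $(A[\sigma],B[\sigma])\in\mathcal R$ for every ground substitution $\sigma$ over $\mathcal V$ with $\models\mathcal C[\sigma]$.
   Context: **Syntax.** Arithmetic variables $n,m,k,\dots$ range over natural numbers; arithmetic expressions are evaluated in the integers; $i$ denotes a constant. - Arithmetic expressions: $e ::= i \mid e+e \mid e-e \mid i\times e \mid n$. - Arithmetic propositions (Presburger arithmetic): $\phi ::= e=e \mid e>e \mid (i \mid e) \mid \top \mid \bot \mid \phi\land\phi \mid \phi\lor\phi \mid \lnot\phi \mid \exists n.\,\phi \mid \forall n.\,\phi$, where $(i\mid e)$ is divisibility by a constant (also $\ge,\le,<$ as abbreviations). - Types: $A,B ::= \oplus\{\ell:A_\ell\}_{\ell\in L} \mid \&\{\ell:A_\ell\}_{\ell\in L} \mid A\otimes B \mid A\multimap B \mid \mathbf{1} \mid {?}\{\phi\}.\,A \mid {!}\{\phi\}.\,A \mid \exists n.\,A \mid \forall n.\,A \mid V[\overline e]$, where $L$ is a finite nonempty set of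 labels, $V$ is a type variable (type name) and $\overline e$ a (possibly empty) sequence of arithmetic expressions. $\exists n.A$ and $\forall n.A$ bind $n$ in $A$; bound variables may be silently renamed. - Signatures: finite lists $\Sigma$ of definitions $V[\overline n\mid\phi]=A$, with distinct defined type variables $V$; definitions may be mutually recursive. $V[\overline n]=A$ abbreviates $V[\overline n\mid \overline n\ge 0]=A$. A closed index expression is identified with its integer value (so closed types $V[\overline e]$ and $V[\overline{e}']$ whose index expressions have equal values are the same type). **Validity.** $\mathcal V;\mathcal C\models\phi$ means that $\forall\mathcal V.\,(\mathcal C\supset\phi)$ is true in arithmetic; $\models\phi$ abbreviates $\cdot\,;\top\models\phi$. The judgment $\mathcal V;\mathcal C\vdash_\Sigma A\ \mathit{valid}$ ($\mathcal V$ a finite collection of arithmetic variables containing all free variables of the proposition $\mathcal C$ and of $A$) is defined inductively: ${?}\{\phi\}.A$ and ${!}\{\phi\}.A$ are valid under $\mathcal V;\mathcal C$ if $A$ is valid under $\mathcal V;\mathcal C\land\phi$; $\exists n.A$ and $\forall n.A$ are valid under $\mathcal V;\mathcal C$ if $A$ is valid under $\mathcal V,n;\mathcal C$ ($n$ fresh); $V[\overline e]$ is valid under $\mathcal V;\mathcal C$ if $V[\overline n\mid\phi]=A\in\Sigma$ for some $A$ and $\mathcal V;\mathcal C\models\phi[\overline e/\overline n]$; $\mathbf 1$ is valid; and types built with $\oplus,\&,\otimes,\multimap$ are valid under $\mathcal V;\mathcal C$ if all their immediate components are. A signature $\Sigma$ is valid if for every definition $V[\overline n\mid\phi]=A$ in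 $\Sigma$, $A$ is not itself of the form $V'[\overline{e}']$ (contractiveness) and $\overline n;\phi\vdash_\Sigma A\ \mathit{valid}$. **Type bisimulation.** A type is closed if it has no free arithmetic variables; closed valid types are those with $\cdot\,;\top\vdash_\Sigma A\ \mathit{valid}$. Define $\mathrm{unfold}_\Sigma(V[\overline e])=A[\overline e/\overline n]$ if $V[\overline n\mid\phi]=A\in\Sigma$, and $\mathrm{unfold}_\Sigma(A)=A$ if $A$ is not of the form $V[\overline e]$. A relation $\mathcal R$ on closed valid types is a type bisimulation if $(A,B)\in\mathcal R$ implies, for $S=\mathrm{unfold}_\Sigma(A)$ and $T=\mathrm{unfold}_\Sigma(B)$: - if $S=\oplus\{\ell:A_\ell\}_{\ell\in L}$ then $T=\oplus\{\ell:B_\ell\}_{\ell\in L}$ (same $L$) and $(A_\ell,B_\ell)\in\mathcal R$ for all $\ell\in L$; likewise with $\&$ in place of $\oplus$; - if $S=A_1\otimes A_2$ then $T=B_1\otimes B_2$ with $(A_1,B_1),(A_2,B_2)\in\mathcal R$; likewise with $\multimap$ in place of $\otimes$; - if $S=\mathbf 1$ then $T=\mathbf 1$; - if $S={?}\{\phi\}.A'$ then $T={?}\{\psi\}.B'$ and either (i) $\models\phi$, $\models\psi$ and $(A',B')\in\mathcal R$, or (ii) $\models\lnot\phi$ and $\models\lnot\psi$; likewise with ${!}$ in place of ${?}$; - if $S=\exists m.A'$ then $T=\exists n.B'$ and $(A'[i/m],B'[i/n])\in\mathcal R$ for all $i\in\mathbb N$; likewise with $\forall$ in place of $\exists$. A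 ground substitution over $\mathcal V$ assigns a natural number to each variable of $\mathcal V$. **Algorithmic judgment.** The judgment $\mathcal V;\mathcal C;\Gamma\vdash A\equiv B$ (relative to the fixed signature $\Sigma$), where $\Gamma$ is a finite collection of closures $\langle\mathcal V';\mathcal C';V_1[\overline{e_1}']\equiv V_2[\overline{e_2}']\rangle$ (whose variables $\mathcal V'$ are bound and may be renamed), is defined inductively by the rules: - ($\oplus$) from $\mathcal V;\mathcal C;\Gamma\vdash A_\ell\equiv B_\ell$ for all $\ell\in L$ infer $\mathcal V;\mathcal C;\Gamma\vdash\oplus\{\ell:A_\ell\}_{\ell\in L}\equiv\oplus\{\ell:B_\ell\}_{\ell\in L}$; ($\&$) likewise for $\&$. - ($\otimes$) from $\mathcal V;\mathcal C;\Gamma\vdash A_1\equiv B_1$ and $\mathcal V;\mathcal C;\Gamma\vdash A_2\equiv B_2$ infer $\mathcal V;\mathcal C;\Gamma\vdash A_1\otimes A_2\equiv B_1\otimes B_2$; ($\multimap$) likewise for $\multimap$. - ($\mathbf 1$) $\mathcal V;\mathcal C;\Gamma\vdash\mathbf 1\equiv\mathbf 1$. - (${?}$) from $\mathcal V;\mathcal C\models\phi\leftrightarrow\psi$ and $\mathcal V;\mathcal C\land\phi;\Gamma\vdash A\equiv B$ infer $\mathcal V;\mathcal C;\Gamma\vdash{?}\{\phi\}.A\equiv{?}\{\psi\}.B$; (${!}$) likewise for ${!}$. - ($\exists$) from $\mathcal V,k;\mathcal C;\Gamma\vdash A[k/m]\equiv B[k/n]$ with $k$ fresh infer $\mathcal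 V;\mathcal C;\Gamma\vdash\exists m.A\equiv\exists n.B$; ($\forall$) likewise for $\forall$. - ($\bot$) from $\mathcal V;\mathcal C\models\bot$ infer $\mathcal V;\mathcal C;\Gamma\vdash A\equiv B$. - (refl) from $\mathcal V;\mathcal C\models e_1=e_1'\land\dots\land e_n=e_n'$ infer $\mathcal V;\mathcal C;\Gamma\vdash V[\overline e]\equiv V[\overline{e}']$. - (expd) if $V_1[\overline{v_1}\mid\phi_1]=A\in\Sigma$, $V_2[\overline{v_2}\mid\phi_2]=B\in\Sigma$ and $\gamma=\langle\mathcal V;\mathcal C;V_1[\overline{e_1}]\equiv V_2[\overline{e_2}]\rangle$, then from $\mathcal V;\mathcal C;\Gamma,\gamma\vdash A[\overline{e_1}/\overline{v_1}]\equiv B[\overline{e_2}/\overline{v_2}]$ infer $\mathcal V;\mathcal C;\Gamma\vdash V_1[\overline{e_1}]\equiv V_2[\overline{e_2}]$. - (def) if $\langle\mathcal V';\mathcal C';V_1[\overline{e_1}']\equiv V_2[\overline{e_2}']\rangle\in\Gamma$ and $\mathcal V;\mathcal C\models\exists\mathcal V'.\,\mathcal C'\land\overline{e_1}'=\overline{e_1}\land\overline{e_2}'=\overline{e_2}$, infer $\mathcal V;\mathcal C;\Gamma\vdash V_1[\overline{e_1}]\equiv V_2[\overline{e_2}]$.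
   Formalization: Validity of V[e] additionally requires that V;C entails e ≥ 0 for every index expression; without this the claim fails, e.g. for V[-1] with V[n|⊤]=1⊗U[n], U[n|n≥0]=1⊗1. *)

theory Defs
  imports Main "HOL-Library.Finite_Map"
begin

(* Variables are de Bruijn indices.  A collection of n arithmetic variables is the number n
   (the variables being 0, ..., n - 1), so extending it by a fresh variable means passing to
   Suc n and shifting what lives in the old context; types are equal up to renaming of
   bound variables by construction. *)

datatype aexp =
    Const int
  | Var nat
  | Add aexp aexp
  | Sub aexp aexp
  | Mul int aexp

datatype aprop =
    Eq aexp aexp
  | Gt aexp aexp
  | Dvd int aexp
  | Tru
  | Fls
  | Conj aprop aprop
  | Disj aprop aprop
  | Neg aprop
  | Exn aprop
  | Alln aprop

abbreviation Geq :: "aexp \<Rightarrow> aexp \<Rightarrow> aprop" where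
  "Geq e e' \<equiv> Disj (Gt e e') (Eq e e')"

abbreviation Iff :: "aprop \<Rightarrow> aprop \<Rightarrow> aprop" where
  "Iff \<phi> \<psi> \<equiv> Conj (Disj (Neg \<phi>) \<psi>) (Disj (Neg \<psi>) \<phi>)"

primrec eval :: "nat list \<Rightarrow> aexp \<Rightarrow> int" where
  "eval \<rho> (Const i) = i"
| "eval \<rho> (Var j) = int (\<rho> ! j)"
| "eval \<rho> (Add e e') = eval \<rho> e + eval \<rho> e'"
| "eval \<rho> (Sub e e') = eval \<rho> e - eval \<rho> e'"
| "eval \<rho> (Mul i e) = i * eval \<rho> e"

primrec sat :: "nat list \<Rightarrow> aprop \<Rightarrow> bool" where
  "sat \<rho> (Eq e e') \<longleftrightarrow> eval \<rho> e = eval \<rho> e'"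
| "sat \<rho> (Gt e e') \<longleftrightarrow> eval \<rho> e > eval \<rho> e'"
| "sat \<rho> (Dvd i e) \<longleftrightarrow> i dvd eval \<rho> e"
| "sat \<rho> Tru \<longleftrightarrow> True"
| "sat \<rho> Fls \<longleftrightarrow> False"
| "sat \<rho> (Conj \<phi> \<psi>) \<longleftrightarrow> sat \<rho> \<phi> \<and> sat \<rho> \<psi>"
| "sat \<rho> (Disj \<phi> \<psi>) \<longleftrightarrow> sat \<rho> \<phi> \<or> sat \<rho> \<psi>"
| "sat \<rho> (Neg \<phi>) \<longleftrightarrow> \<not> sat \<rho> \<phi>"
| "sat \<rho> (Exn \<phi>) \<longleftrightarrow> (\<exists>i. sat (i # \<rho>) \<phi>)"
| "sat \<rho> (Alln \<phi>) \<longleftrightarrow> (\<forall>i. sat (i # \<rho>) \<phi>)"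

definition entails :: "nat \<Rightarrow> aprop \<Rightarrow> aprop \<Rightarrow> bool" where
  "entails n C \<phi> \<longleftrightarrow> (\<forall>\<rho>. length \<rho> = n \<longrightarrow> sat \<rho> C \<longrightarrow> sat \<rho> \<phi>)"

abbreviation true_prop :: "aprop \<Rightarrow> bool" where
  "true_prop \<phi> \<equiv> entails 0 Tru \<phi>"

(* exp_over n e, prop_over n \<phi>: all free variables are among the n variables of the context *)

primrec exp_over :: "nat \<Rightarrow> aexp \<Rightarrow> bool" where
  "exp_over n (Const i) \<longleftrightarrow> True"
| "exp_over n (Var j) \<longleftrightarrow> j < n"
| "exp_over n (Add e e') \<longleftrightarrow> exp_over n e \<and> exp_over n e'"
| "exp_over n (Sub e e') \<longleftrightarrow> exp_over n e \<and> exp_over n e'"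
| "exp_over n (Mul i e) \<longleftrightarrow> exp_over n e"

primrec prop_over :: "nat \<Rightarrow> aprop \<Rightarrow> bool" where
  "prop_over n (Eq e e') \<longleftrightarrow> exp_over n e \<and> exp_over n e'"
| "prop_over n (Gt e e') \<longleftrightarrow> exp_over n e \<and> exp_over n e'"
| "prop_over n (Dvd i e) \<longleftrightarrow> exp_over n e"
| "prop_over n Tru \<longleftrightarrow> True"
| "prop_over n Fls \<longleftrightarrow> True"
| "prop_over n (Conj \<phi> \<psi>) \<longleftrightarrow> prop_over n \<phi> \<and> prop_over n \<psi>"
| "prop_over n (Disj \<phi> \<psi>) \<longleftrightarrow> prop_over n \<phi> \<and> prop_over n \<psi>"
| "prop_over n (Neg \<phi>) \<longleftrightarrow> prop_over n \<phi>"
| "prop_over n (Exn \<phi>) \<longleftrightarrow> prop_over (Suc n) \<phi>"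
| "prop_over n (Alln \<phi>) \<longleftrightarrow> prop_over (Suc n) \<phi>"

primrec subst_exp :: "(nat \<Rightarrow> aexp) \<Rightarrow> aexp \<Rightarrow> aexp" where
  "subst_exp \<theta> (Const i) = Const i"
| "subst_exp \<theta> (Var j) = \<theta> j"
| "subst_exp \<theta> (Add e e') = Add (subst_exp \<theta> e) (subst_exp \<theta> e')"
| "subst_exp \<theta> (Sub e e') = Sub (subst_exp \<theta> e) (subst_exp \<theta> e')"
| "subst_exp \<theta> (Mul i e) = Mul i (subst_exp \<theta> e)"

abbreviation shift_exp :: "nat \<Rightarrow> aexp \<Rightarrow> aexp" where
  "shift_exp k \<equiv> subst_exp (\<lambda>j. Var (j + k))"

definition under_binder :: "(nat \<Rightarrow> aexp) \<Rightarrow> nat \<Rightarrow> aexp" where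
  "under_binder \<theta> j = (case j of 0 \<Rightarrow> Var 0 | Suc j' \<Rightarrow> shift_exp 1 (\<theta> j'))"

primrec subst_prop :: "(nat \<Rightarrow> aexp) \<Rightarrow> aprop \<Rightarrow> aprop" where
  "subst_prop \<theta> (Eq e e') = Eq (subst_exp \<theta> e) (subst_exp \<theta> e')"
| "subst_prop \<theta> (Gt e e') = Gt (subst_exp \<theta> e) (subst_exp \<theta> e')"
| "subst_prop \<theta> (Dvd i e) = Dvd i (subst_exp \<theta> e)"
| "subst_prop \<theta> Tru = Tru"
| "subst_prop \<theta> Fls = Fls"
| "subst_prop \<theta> (Conj \<phi> \<psi>) = Conj (subst_prop \<theta> \<phi>) (subst_prop \<theta> \<psi>)"
| "subst_prop \<theta> (Disj \<phi> \<psi>) = Disj (subst_prop \<theta> \<phi>) (subst_prop \<theta> \<psi>)"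
| "subst_prop \<theta> (Neg \<phi>) = Neg (subst_prop \<theta> \<phi>)"
| "subst_prop \<theta> (Exn \<phi>) = Exn (subst_prop (under_binder \<theta>) \<phi>)"
| "subst_prop \<theta> (Alln \<phi>) = Alln (subst_prop (under_binder \<theta>) \<phi>)"

abbreviation shift_prop :: "nat \<Rightarrow> aprop \<Rightarrow> aprop" where
  "shift_prop k \<equiv> subst_prop (\<lambda>j. Var (j + k))"

(* The simultaneous substitution es/(0, ..., length es - 1); the remaining variables
   lose the substituted ones below them. *)
definition inst :: "aexp list \<Rightarrow> nat \<Rightarrow> aexp" where
  "inst es j = (if j < length es then es ! j else Var (j - length es))"

definition ground :: "nat list \<Rightarrow> nat \<Rightarrow> aexp" where
  "ground \<sigma> = inst (map (\<lambda>i. Const (int i)) \<sigma>)"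

definition all_eq :: "aexp list \<Rightarrow> aexp list \<Rightarrow> aprop" where
  "all_eq es es' = foldr Conj (map2 Eq es es') Tru"

definition all_nonneg :: "aexp list \<Rightarrow> aprop" where
  "all_nonneg es = foldr Conj (map (\<lambda>e. Geq e (Const 0)) es) Tru"

definition exns :: "nat \<Rightarrow> aprop \<Rightarrow> aprop" where
  "exns k \<phi> = (Exn ^^ k) \<phi>"

(* In order: internal and external choice, tensor, lolli, the unit, ?{\<phi>}. A, !{\<phi>}. A,
   the two quantifiers, V[es].  'l is the type of labels, 'v that of type names. *)
datatype ('l, 'v) tp =
    Plus "('l, ('l, 'v) tp) fmap"
  | With "('l, ('l, 'v) tp) fmap"
  | Tensor "('l, 'v) tp" "('l, 'v) tp"
  | Lolli "('l, 'v) tp" "('l, 'v) tp"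
  | One
  | Quest aprop "('l, 'v) tp"
  | Bang aprop "('l, 'v) tp"
  | TEx "('l, 'v) tp"
  | TAll "('l, 'v) tp"
  | Name 'v "aexp list"

primrec subst_tp :: "('l, 'v) tp \<Rightarrow> (nat \<Rightarrow> aexp) \<Rightarrow> ('l, 'v) tp" where
  "subst_tp (Plus f) = (\<lambda>\<theta>. Plus (fmmap (\<lambda>s. s \<theta>) (fmmap subst_tp f)))"
| "subst_tp (With f) = (\<lambda>\<theta>. With (fmmap (\<lambda>s. s \<theta>) (fmmap subst_tp f)))"
| "subst_tp (Tensor A B) = (\<lambda>\<theta>. Tensor (subst_tp A \<theta>) (subst_tp B \<theta>))"
| "subst_tp (Lolli A B) = (\<lambda>\<theta>. Lolli (subst_tp A \<theta>) (subst_tp B \<theta>))"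
| "subst_tp One = (\<lambda>\<theta>. One)"
| "subst_tp (Quest \<phi> A) = (\<lambda>\<theta>. Quest (subst_prop \<theta> \<phi>) (subst_tp A \<theta>))"
| "subst_tp (Bang \<phi> A) = (\<lambda>\<theta>. Bang (subst_prop \<theta> \<phi>) (subst_tp A \<theta>))"
| "subst_tp (TEx A) = (\<lambda>\<theta>. TEx (subst_tp A (under_binder \<theta>)))"
| "subst_tp (TAll A) = (\<lambda>\<theta>. TAll (subst_tp A (under_binder \<theta>)))"
| "subst_tp (Name V es) = (\<lambda>\<theta>. Name V (map (subst_exp \<theta>) es))"

(* (V, k, \<phi>, A) is the definition V[n\<^sub>1, ..., n\<^sub>k | \<phi>] = A, whose parameters are the
   variables 0, ..., k - 1 of \<phi> and A. *)
type_synonym ('l, 'v) signature = "('v \<times> nat \<times> aprop \<times> ('l, 'v) tp) list"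

(* The syntactic side conditions (non-empty label sets, free variables within the context,
   matching arities) are part of the rules.  The parameters of a definition are arithmetic
   variables and hence range over natural numbers, while index expressions are evaluated in
   the integers; rule name therefore asks that the index expressions are admissible values for
   the parameters.  This is implied by the second entailment whenever the constraint forces
   n\<^sub>i >= 0, as the default constraint does.  Without it validity would not be preserved by
   unfolding: with V[n | true] = 1 * U[n] and U[n | n >= 0] = 1 * 1, the type V[-1] would be
   valid but its component U[-1] would not. *)
inductive valid_tp :: "('l, 'v) signature \<Rightarrow> nat \<Rightarrow> aprop \<Rightarrow> ('l, 'v) tp \<Rightarrow> bool"
  for \<Sigma> :: "('l, 'v) signature" where
  plus: "f \<noteq> fmempty \<Longrightarrow> (\<And>l A. fmlookup f l = Some A \<Longrightarrow> valid_tp \<Sigma> n C A)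
    \<Longrightarrow> valid_tp \<Sigma> n C (Plus f)"
| "with": "f \<noteq> fmempty \<Longrightarrow> (\<And>l A. fmlookup f l = Some A \<Longrightarrow> valid_tp \<Sigma> n C A)
    \<Longrightarrow> valid_tp \<Sigma> n C (With f)"
| tensor: "valid_tp \<Sigma> n C A \<Longrightarrow> valid_tp \<Sigma> n C B \<Longrightarrow> valid_tp \<Sigma> n C (Tensor A B)"
| lolli: "valid_tp \<Sigma> n C A \<Longrightarrow> valid_tp \<Sigma> n C B \<Longrightarrow> valid_tp \<Sigma> n C (Lolli A B)"
| one: "valid_tp \<Sigma> n C One"
| quest: "prop_over n \<phi> \<Longrightarrow> valid_tp \<Sigma> n (Conj C \<phi>) A \<Longrightarrow> valid_tp \<Sigma> n C (Quest \<phi> A)"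
| bang: "prop_over n \<phi> \<Longrightarrow> valid_tp \<Sigma> n (Conj C \<phi>) A \<Longrightarrow> valid_tp \<Sigma> n C (Bang \<phi> A)"
| ex: "valid_tp \<Sigma> (Suc n) (shift_prop 1 C) A \<Longrightarrow> valid_tp \<Sigma> n C (TEx A)"
| all: "valid_tp \<Sigma> (Suc n) (shift_prop 1 C) A \<Longrightarrow> valid_tp \<Sigma> n C (TAll A)"
| name: "(V, k, \<phi>, A) \<in> set \<Sigma> \<Longrightarrow> length es = k \<Longrightarrow> (\<forall>e\<in>set es. exp_over n e)
    \<Longrightarrow> entails n C (all_nonneg es) \<Longrightarrow> entails n C (subst_prop (inst es) \<phi>)
    \<Longrightarrow> valid_tp \<Sigma> n C (Name V es)"

definition valid_signature :: "('l, 'v) signature \<Rightarrow> bool" where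
  "valid_signature \<Sigma> \<longleftrightarrow>
     distinct (map fst \<Sigma>) \<and>
     (\<forall>(V, k, \<phi>, A) \<in> set \<Sigma>.
        prop_over k \<phi> \<and> (\<nexists>V' es. A = Name V' es) \<and> valid_tp \<Sigma> k \<phi> A)"

abbreviation closed_valid :: "('l, 'v) signature \<Rightarrow> ('l, 'v) tp \<Rightarrow> bool" where
  "closed_valid \<Sigma> A \<equiv> valid_tp \<Sigma> 0 Tru A"

definition unfold :: "('l, 'v) signature \<Rightarrow> ('l, 'v) tp \<Rightarrow> ('l, 'v) tp" where
  "unfold \<Sigma> A = (case A of
      Name V es \<Rightarrow> (case map_of \<Sigma> V of
          Some (k, \<phi>, B) \<Rightarrow> subst_tp B (inst es)
        | None \<Rightarrow> A)
    | _ \<Rightarrow> A)"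

(* Closed expressions are identified with their values: val_tp replaces every closed expression
   in a type by its value, and types with the same val_tp count as the same type. *)

definition val_of :: "aexp \<Rightarrow> aexp \<Rightarrow> aexp" where
  "val_of e e' = (if exp_over 0 e then Const (eval [] e) else e')"

primrec val_exp :: "aexp \<Rightarrow> aexp" where
  "val_exp (Const i) = Const i"
| "val_exp (Var j) = Var j"
| "val_exp (Add e e') = val_of (Add e e') (Add (val_exp e) (val_exp e'))"
| "val_exp (Sub e e') = val_of (Sub e e') (Sub (val_exp e) (val_exp e'))"
| "val_exp (Mul i e) = val_of (Mul i e) (Mul i (val_exp e))"

primrec val_prop :: "aprop \<Rightarrow> aprop" where
  "val_prop (Eq e e') = Eq (val_exp e) (val_exp e')"
| "val_prop (Gt e e') = Gt (val_exp e) (val_exp e')"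
| "val_prop (Dvd i e) = Dvd i (val_exp e)"
| "val_prop Tru = Tru"
| "val_prop Fls = Fls"
| "val_prop (Conj \<phi> \<psi>) = Conj (val_prop \<phi>) (val_prop \<psi>)"
| "val_prop (Disj \<phi> \<psi>) = Disj (val_prop \<phi>) (val_prop \<psi>)"
| "val_prop (Neg \<phi>) = Neg (val_prop \<phi>)"
| "val_prop (Exn \<phi>) = Exn (val_prop \<phi>)"
| "val_prop (Alln \<phi>) = Alln (val_prop \<phi>)"

primrec val_tp :: "('l, 'v) tp \<Rightarrow> ('l, 'v) tp" where
  "val_tp (Plus f) = Plus (fmmap val_tp f)"
| "val_tp (With f) = With (fmmap val_tp f)"
| "val_tp (Tensor A B) = Tensor (val_tp A) (val_tp B)"
| "val_tp (Lolli A B) = Lolli (val_tp A) (val_tp B)"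
| "val_tp One = One"
| "val_tp (Quest \<phi> A) = Quest (val_prop \<phi>) (val_tp A)"
| "val_tp (Bang \<phi> A) = Bang (val_prop \<phi>) (val_tp A)"
| "val_tp (TEx A) = TEx (val_tp A)"
| "val_tp (TAll A) = TAll (val_tp A)"
| "val_tp (Name V es) = Name V (map val_exp es)"

(* By contractiveness, the last clause is never used on valid types over a valid signature. *)
primrec bisim_step ::
  "('l, 'v) tp rel \<Rightarrow> ('l, 'v) tp \<Rightarrow> ('l, 'v) tp \<Rightarrow> bool" where
  "bisim_step R (Plus f) T \<longleftrightarrow> (\<exists>g. T = Plus g \<and> fmrel (\<lambda>A B. (A, B) \<in> R) f g)"
| "bisim_step R (With f) T \<longleftrightarrow> (\<exists>g. T = With g \<and> fmrel (\<lambda>A B. (A, B) \<in> R) f g)"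
| "bisim_step R (Tensor A\<^sub>1 A\<^sub>2) T \<longleftrightarrow>
     (\<exists>B\<^sub>1 B\<^sub>2. T = Tensor B\<^sub>1 B\<^sub>2 \<and> (A\<^sub>1, B\<^sub>1) \<in> R \<and> (A\<^sub>2, B\<^sub>2) \<in> R)"
| "bisim_step R (Lolli A\<^sub>1 A\<^sub>2) T \<longleftrightarrow>
     (\<exists>B\<^sub>1 B\<^sub>2. T = Lolli B\<^sub>1 B\<^sub>2 \<and> (A\<^sub>1, B\<^sub>1) \<in> R \<and> (A\<^sub>2, B\<^sub>2) \<in> R)"
| "bisim_step R One T \<longleftrightarrow> T = One"
| "bisim_step R (Quest \<phi> A) T \<longleftrightarrow>
     (\<exists>\<psi> B. T = Quest \<psi> B \<and>
        (true_prop \<phi> \<and> true_prop \<psi> \<and> (A, B) \<in> R \<or>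
         true_prop (Neg \<phi>) \<and> true_prop (Neg \<psi>)))"
| "bisim_step R (Bang \<phi> A) T \<longleftrightarrow>
     (\<exists>\<psi> B. T = Bang \<psi> B \<and>
        (true_prop \<phi> \<and> true_prop \<psi> \<and> (A, B) \<in> R \<or>
         true_prop (Neg \<phi>) \<and> true_prop (Neg \<psi>)))"
| "bisim_step R (TEx A) T \<longleftrightarrow>
     (\<exists>B. T = TEx B \<and> (\<forall>i. (subst_tp A (ground [i]), subst_tp B (ground [i])) \<in> R))"
| "bisim_step R (TAll A) T \<longleftrightarrow>
     (\<exists>B. T = TAll B \<and> (\<forall>i. (subst_tp A (ground [i]), subst_tp B (ground [i])) \<in> R))"
| "bisim_step R (Name V es) T \<longleftrightarrow> True"

definition type_bisimulation :: "('l, 'v) signature \<Rightarrow> ('l, 'v) tp rel \<Rightarrow> bool" where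
  "type_bisimulation \<Sigma> R \<longleftrightarrow>
     (\<forall>(A, B) \<in> R. closed_valid \<Sigma> A \<and> closed_valid \<Sigma> B) \<and>
     (\<forall>(A, B) \<in> R. \<forall>A' B'. val_tp A' = val_tp A \<longrightarrow> val_tp B' = val_tp B \<longrightarrow> (A', B') \<in> R) \<and>
     (\<forall>(A, B) \<in> R. bisim_step R (unfold \<Sigma> A) (unfold \<Sigma> B))"

(* Closure n C V es W es' stands for < n ; C ; V[es] == W[es'] > *)
datatype 'v closure = Closure nat aprop 'v "aexp list" 'v "aexp list"

inductive tp_eq ::
  "('l, 'v) signature \<Rightarrow> nat \<Rightarrow> aprop \<Rightarrow> 'v closure list \<Rightarrow>
     ('l, 'v) tp \<Rightarrow> ('l, 'v) tp \<Rightarrow> bool"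
  for \<Sigma> :: "('l, 'v) signature" where
  plus: "fmrel (\<lambda>A B. tp_eq \<Sigma> n C \<Gamma> A B) f g \<Longrightarrow> tp_eq \<Sigma> n C \<Gamma> (Plus f) (Plus g)"
| "with": "fmrel (\<lambda>A B. tp_eq \<Sigma> n C \<Gamma> A B) f g \<Longrightarrow> tp_eq \<Sigma> n C \<Gamma> (With f) (With g)"
| tensor: "tp_eq \<Sigma> n C \<Gamma> A\<^sub>1 B\<^sub>1 \<Longrightarrow> tp_eq \<Sigma> n C \<Gamma> A\<^sub>2 B\<^sub>2
    \<Longrightarrow> tp_eq \<Sigma> n C \<Gamma> (Tensor A\<^sub>1 A\<^sub>2) (Tensor B\<^sub>1 B\<^sub>2)"
| lolli: "tp_eq \<Sigma> n C \<Gamma> A\<^sub>1 B\<^sub>1 \<Longrightarrow> tp_eq \<Sigma> n C \<Gamma> A\<^sub>2 B\<^sub>2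
    \<Longrightarrow> tp_eq \<Sigma> n C \<Gamma> (Lolli A\<^sub>1 A\<^sub>2) (Lolli B\<^sub>1 B\<^sub>2)"
| one: "tp_eq \<Sigma> n C \<Gamma> One One"
| quest: "entails n C (Iff \<phi> \<psi>) \<Longrightarrow> tp_eq \<Sigma> n (Conj C \<phi>) \<Gamma> A B
    \<Longrightarrow> tp_eq \<Sigma> n C \<Gamma> (Quest \<phi> A) (Quest \<psi> B)"
| bang: "entails n C (Iff \<phi> \<psi>) \<Longrightarrow> tp_eq \<Sigma> n (Conj C \<phi>) \<Gamma> A B
    \<Longrightarrow> tp_eq \<Sigma> n C \<Gamma> (Bang \<phi> A) (Bang \<psi> B)"
| ex: "tp_eq \<Sigma> (Suc n) (shift_prop 1 C) \<Gamma> A B \<Longrightarrow> tp_eq \<Sigma> n C \<Gamma> (TEx A) (TEx B)"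
| all: "tp_eq \<Sigma> (Suc n) (shift_prop 1 C) \<Gamma> A B \<Longrightarrow> tp_eq \<Sigma> n C \<Gamma> (TAll A) (TAll B)"
| bot: "entails n C Fls \<Longrightarrow> tp_eq \<Sigma> n C \<Gamma> A B"
| refl: "length es = length es' \<Longrightarrow> entails n C (all_eq es es')
    \<Longrightarrow> tp_eq \<Sigma> n C \<Gamma> (Name V es) (Name V es')"
| expd: "(V\<^sub>1, k\<^sub>1, \<phi>\<^sub>1, A) \<in> set \<Sigma> \<Longrightarrow> length es\<^sub>1 = k\<^sub>1
    \<Longrightarrow> (V\<^sub>2, k\<^sub>2, \<phi>\<^sub>2, B) \<in> set \<Sigma> \<Longrightarrow> length es\<^sub>2 = k\<^sub>2
    \<Longrightarrow> tp_eq \<Sigma> n C (Closure n C V\<^sub>1 es\<^sub>1 V\<^sub>2 es\<^sub>2 # \<Gamma>)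
          (subst_tp A (inst es\<^sub>1)) (subst_tp B (inst es\<^sub>2))
    \<Longrightarrow> tp_eq \<Sigma> n C \<Gamma> (Name V\<^sub>1 es\<^sub>1) (Name V\<^sub>2 es\<^sub>2)"
  (* Below the n' quantifiers, the variables of C', es\<^sub>1', es\<^sub>2' are bound and those of the
     ambient context are shifted by n'. *)
| "def": "Closure n' C' V\<^sub>1 es\<^sub>1' V\<^sub>2 es\<^sub>2' \<in> set \<Gamma>
    \<Longrightarrow> length es\<^sub>1' = length es\<^sub>1 \<Longrightarrow> length es\<^sub>2' = length es\<^sub>2
    \<Longrightarrow> entails n C (exns n' (Conj C' (Conj
          (all_eq es\<^sub>1' (map (shift_exp n') es\<^sub>1))
          (all_eq es\<^sub>2' (map (shift_exp n') es\<^sub>2)))))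
    \<Longrightarrow> tp_eq \<Sigma> n C \<Gamma> (Name V\<^sub>1 es\<^sub>1) (Name V\<^sub>2 es\<^sub>2)"
  monos fmap.rel_mono

end

theory Submission
  imports Defs
begin

text \<open>
  Bisimilarity is approximated by relations indexed by the number of unfoldings, whose intersection
  on closed valid types is a type bisimulation.  By induction on a derivation, if all closures
  of the context hold up to depth \<open>k\<close>, then so does its conclusion, and a conclusion about types
  that are not names even holds up to depth \<open>k + 1\<close>.  Since the bodies of definitions are not names,
  a closure added by rule \<open>expd\<close> is justified by induction on \<open>k\<close>.
\<close>

section \<open>Substitution\<close>

text \<open>The obstacle is that rule \<open>expd\<close> assumes the very equation it concludes. If
  soundness only kept the depth \<open>k\<close> of the closures, nothing could discharge that
  assumption; claiming depth \<open>k + 1\<close> for all conclusions fails at rule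
  \<open>def\<close>, which hands a closure back unchanged. The extra level is earned by the
  structural rules, and contractiveness puts one of them (or rule \<open>bot\<close>) between
  \<open>expd\<close> and every use of its closure. A name and its body have the same unfolding, so
  the level earned for bodies is earned for the names as well.

  Rule \<open>def\<close> recalls a closure only up to the integer values of the index expressions,
  and a type bisimulation has to respect these values too. Hence the study of \<open>val_tp\<close>
  and of its compatibility with substitution, unfolding and validity.

  Validity plays no part in the approximations themselves. It is imposed on their intersection,
  where it survives unfolding because index expressions denote natural numbers.\<close>

lemma under_binder_simps [simp]:
  "under_binder \<theta> 0 = Var 0"
  "under_binder \<theta> (Suc j) = shift_exp 1 (\<theta> j)"
  by (simp_all add: under_binder_def)

lemma subst_exp_Var [simp]: "subst_exp Var e = e"
  by (induction e) auto

lemma under_binder_Var [simp]: "under_binder Var = Var"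
proof
  fix j show "under_binder Var j = Var j" by (cases j) simp_all
qed

lemma subst_prop_Var [simp]: "subst_prop Var \<phi> = \<phi>"
  by (induction \<phi>) auto

lemma subst_exp_subst: "subst_exp \<eta> (subst_exp \<theta> e) = subst_exp (\<lambda>j. subst_exp \<eta> (\<theta> j)) e"
  by (induction e) auto

lemma under_binder_subst:
  "(\<lambda>j. subst_exp (under_binder \<eta>) (under_binder \<theta> j)) = under_binder (\<lambda>j. subst_exp \<eta> (\<theta> j))"
proof
  fix j
  show "subst_exp (under_binder \<eta>) (under_binder \<theta> j) = under_binder (\<lambda>j. subst_exp \<eta> (\<theta> j)) j"
    by (cases j) (simp_all add: subst_exp_subst)
qed

lemma subst_prop_subst: "subst_prop \<eta> (subst_prop \<theta> \<phi>) = subst_prop (\<lambda>j. subst_exp \<eta> (\<theta> j)) \<phi>"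
  by (induction \<phi> arbitrary: \<eta> \<theta>) (simp_all add: subst_exp_subst under_binder_subst)

text \<open>The substitution changes under binders, so the recursion returns a function of it and
  applies the components in a second \<open>fmmap\<close>. Fusing the two maps gives the usable
  equations.\<close>

lemma subst_tp_fmap [simp]:
  "subst_tp (Plus f) \<theta> = Plus (fmmap (\<lambda>A. subst_tp A \<theta>) f)"
  "subst_tp (With f) \<theta> = With (fmmap (\<lambda>A. subst_tp A \<theta>) f)"
  by (simp_all add: fmap.map_comp comp_def)

declare subst_tp.simps(1,2) [simp del]

lemma subst_tp_subst: "subst_tp (subst_tp A \<theta>) \<eta> = subst_tp A (\<lambda>j. subst_exp \<eta> (\<theta> j))"
proof (induction A arbitrary: \<theta> \<eta>)
  case (Plus f)
  then show ?case by (auto simp: fmap.map_comp intro!: fmap.map_cong0)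
next
  case (With f)
  then show ?case by (auto simp: fmap.map_comp intro!: fmap.map_cong0)
qed (simp_all add: subst_prop_subst subst_exp_subst under_binder_subst)

lemma exp_over_subst:
  "exp_over n e \<Longrightarrow> (\<And>j. j < n \<Longrightarrow> exp_over m (\<theta> j)) \<Longrightarrow> exp_over m (subst_exp \<theta> e)"
  by (induction e) auto

lemma exp_over_under_binder:
  assumes "\<And>j. j < n \<Longrightarrow> exp_over m (\<theta> j)" "j < Suc n"
  shows "exp_over (Suc m) (under_binder \<theta> j)"
  using assms by (cases j) (auto intro!: exp_over_subst[where n = m])

lemma prop_over_subst:
  "prop_over n \<phi> \<Longrightarrow> (\<And>j. j < n \<Longrightarrow> exp_over m (\<theta> j)) \<Longrightarrow> prop_over m (subst_prop \<theta> \<phi>)"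
proof (induction \<phi> arbitrary: n m \<theta>)
  case (Exn \<phi>)
  show ?case using Exn.prems by (auto intro!: Exn.IH[of "Suc n"] exp_over_under_binder[of n])
next
  case (Alln \<phi>)
  show ?case using Alln.prems by (auto intro!: Alln.IH[of "Suc n"] exp_over_under_binder[of n])
qed (auto intro: exp_over_subst)

lemma prop_over_shift: "prop_over n C \<Longrightarrow> prop_over (Suc n) (shift_prop 1 C)"
  by (auto elim: prop_over_subst)

lemma subst_exp_cong:
  "exp_over n e \<Longrightarrow> (\<And>j. j < n \<Longrightarrow> \<theta> j = \<theta>' j) \<Longrightarrow> subst_exp \<theta> e = subst_exp \<theta>' e"
  by (induction e) auto

lemma under_binder_cong:
  assumes "\<And>j. j < n \<Longrightarrow> \<theta> j = \<theta>' j" "j < Suc n"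
  shows "under_binder \<theta> j = under_binder \<theta>' j"
  using assms by (cases j) auto

lemma subst_prop_cong:
  "prop_over n \<phi> \<Longrightarrow> (\<And>j. j < n \<Longrightarrow> \<theta> j = \<theta>' j) \<Longrightarrow> subst_prop \<theta> \<phi> = subst_prop \<theta>' \<phi>"
proof (induction \<phi> arbitrary: n \<theta> \<theta>')
  case (Exn \<phi>)
  show ?case using Exn.prems by (auto intro!: Exn.IH[of "Suc n"] under_binder_cong[of n])
next
  case (Alln \<phi>)
  show ?case using Alln.prems by (auto intro!: Alln.IH[of "Suc n"] under_binder_cong[of n])
next
  case (Conj \<phi> \<psi>)
  show ?case using Conj.prems by (simp add: Conj.IH[of n \<theta> \<theta>'])
next
  case (Disj \<phi> \<psi>)
  show ?case using Disj.prems by (simp add: Disj.IH[of n \<theta> \<theta>'])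
next
  case (Neg \<phi>)
  show ?case using Neg.prems by (simp add: Neg.IH[of n \<theta> \<theta>'])
qed (auto intro: subst_exp_cong)

text \<open>Validity serves here as the bound on the free variables of a type, for which there is no
  separate predicate.\<close>

lemma subst_tp_cong:
  "valid_tp \<Sigma> n C A \<Longrightarrow> (\<And>j. j < n \<Longrightarrow> \<theta> j = \<theta>' j) \<Longrightarrow> subst_tp A \<theta> = subst_tp A \<theta>'"
proof (induction arbitrary: \<theta> \<theta>' rule: valid_tp.induct)
  case (plus f n C)
  show ?case using plus.IH[of _ _ \<theta> \<theta>', OF _ plus.prems]
    by (auto intro!: fmap.map_cong0 simp: fmlookup_ran'_iff)
next
  case ("with" f n C)
  show ?case using "with.IH"[of _ _ \<theta> \<theta>', OF _ "with.prems"]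
    by (auto intro!: fmap.map_cong0 simp: fmlookup_ran'_iff)
next
  case (tensor n C A B)
  show ?case using tensor.prems by (simp add: tensor.IH[of \<theta> \<theta>'])
next
  case (lolli n C A B)
  show ?case using lolli.prems by (simp add: lolli.IH[of \<theta> \<theta>'])
next
  case (quest n \<phi> C A)
  show ?case using quest.hyps(1) quest.prems by (simp add: quest.IH[of \<theta> \<theta>'] subst_prop_cong[of n \<phi> \<theta> \<theta>'])
next
  case (bang n \<phi> C A)
  show ?case using bang.hyps(1) bang.prems by (simp add: bang.IH[of \<theta> \<theta>'] subst_prop_cong[of n \<phi> \<theta> \<theta>'])
next
  case (ex n C A)
  show ?case using ex.prems by (auto intro!: ex.IH under_binder_cong[of n])
next
  case (all n C A)
  show ?case using all.prems by (auto intro!: all.IH under_binder_cong[of n])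
next
  case (name V k \<phi> A es n C)
  then show ?case by (auto intro: subst_exp_cong)
qed simp

section \<open>Semantics\<close>

text \<open>Two instances are compared, rather than an instance and an environment, because
  expressions take any integer value while environments hold natural numbers. Taking
  \<open>Var\<close> for \<open>\<theta>'\<close> gives the usual substitution lemma.\<close>

lemma eval_subst_cong:
  "exp_over n e \<Longrightarrow> (\<And>j. j < n \<Longrightarrow> eval \<rho> (\<theta> j) = eval \<rho>' (\<theta>' j))
    \<Longrightarrow> eval \<rho> (subst_exp \<theta> e) = eval \<rho>' (subst_exp \<theta>' e)"
  by (induction e) auto

lemma eval_subst:
  "exp_over n e \<Longrightarrow> (\<And>j. j < n \<Longrightarrow> eval \<rho> (\<theta> j) = int (\<rho>' ! j))
    \<Longrightarrow> eval \<rho> (subst_exp \<theta> e) = eval \<rho>' e"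
  using eval_subst_cong[of n e \<rho> \<theta> \<rho>' Var] by simp

lemma eval_append: "exp_over (length \<tau>) e \<Longrightarrow> eval (\<tau> @ \<rho>) e = eval \<tau> e"
  by (induction e) (auto simp: nth_append)

lemma eval_shift: "eval (\<tau> @ \<rho>) (shift_exp (length \<tau>) e) = eval \<rho> e"
  by (induction e) (auto simp: nth_append)

lemma eval_shift_Cons [simp]: "eval (i # \<rho>) (shift_exp (Suc 0) e) = eval \<rho> e"
  using eval_shift[of "[i]" \<rho> e] by simp

lemma eval_under_binder_cong:
  assumes "\<And>j. j < n \<Longrightarrow> eval \<rho> (\<theta> j) = eval \<rho>' (\<theta>' j)" "j < Suc n"
  shows "eval (i # \<rho>) (under_binder \<theta> j) = eval (i # \<rho>') (under_binder \<theta>' j)"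
  using assms eval_shift_Cons by (cases j) auto

lemma sat_subst_cong:
  "prop_over n \<phi> \<Longrightarrow> (\<And>j. j < n \<Longrightarrow> eval \<rho> (\<theta> j) = eval \<rho>' (\<theta>' j))
    \<Longrightarrow> sat \<rho> (subst_prop \<theta> \<phi>) = sat \<rho>' (subst_prop \<theta>' \<phi>)"
proof (induction \<phi> arbitrary: n \<rho> \<rho>' \<theta> \<theta>')
  case (Exn \<phi>)
  have "sat (i # \<rho>) (subst_prop (under_binder \<theta>) \<phi>) = sat (i # \<rho>') (subst_prop (under_binder \<theta>') \<phi>)" for i
    using Exn.prems by (auto intro!: Exn.IH[of "Suc n"] eval_under_binder_cong[of n])
  then show ?case by simp
next
  case (Alln \<phi>)
  have "sat (i # \<rho>) (subst_prop (under_binder \<theta>) \<phi>) = sat (i # \<rho>') (subst_prop (under_binder \<theta>') \<phi>)" for i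
    using Alln.prems by (auto intro!: Alln.IH[of "Suc n"] eval_under_binder_cong[of n])
  then show ?case by simp
next
  case (Conj \<phi> \<psi>)
  show ?case using Conj.prems by (simp add: Conj.IH[of n \<rho> \<theta> \<rho>' \<theta>'])
next
  case (Disj \<phi> \<psi>)
  show ?case using Disj.prems by (simp add: Disj.IH[of n \<rho> \<theta> \<rho>' \<theta>'])
next
  case (Neg \<phi>)
  show ?case using Neg.prems by (simp add: Neg.IH[of n \<rho> \<theta> \<rho>' \<theta>'])
next
  case (Eq e e')
  then show ?case by (simp add: eval_subst_cong[of n _ \<rho> \<theta> \<rho>' \<theta>'])
next
  case (Gt e e')
  then show ?case by (simp add: eval_subst_cong[of n _ \<rho> \<theta> \<rho>' \<theta>'])
next
  case (Dvd i e)
  then show ?case by (simp add: eval_subst_cong[of n _ \<rho> \<theta> \<rho>' \<theta>'])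
qed simp_all

lemma sat_subst:
  "prop_over n \<phi> \<Longrightarrow> (\<And>j. j < n \<Longrightarrow> eval \<rho> (\<theta> j) = int (\<rho>' ! j))
    \<Longrightarrow> sat \<rho> (subst_prop \<theta> \<phi>) = sat \<rho>' \<phi>"
  using sat_subst_cong[of n \<phi> \<rho> \<theta> \<rho>' Var] by simp

lemma sat_append: "prop_over (length \<tau>) \<phi> \<Longrightarrow> sat (\<tau> @ \<rho>) \<phi> = sat \<tau> \<phi>"
  using sat_subst[of "length \<tau>" \<phi> "\<tau> @ \<rho>" Var \<tau>] by (simp add: nth_append)

lemma sat_shift: "prop_over n C \<Longrightarrow> sat (i # \<rho>) (shift_prop 1 C) = sat \<rho> C"
  by (rule sat_subst) auto

lemma ground_nth: "j < length \<sigma> \<Longrightarrow> ground \<sigma> j = Const (int (\<sigma> ! j))"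
  by (simp add: ground_def inst_def)

lemma eval_ground: "exp_over (length \<sigma>) e \<Longrightarrow> eval \<rho> (subst_exp (ground \<sigma>) e) = eval \<sigma> e"
  by (rule eval_subst) (auto simp: ground_nth)

lemma sat_ground: "prop_over (length \<sigma>) \<phi> \<Longrightarrow> sat \<rho> (subst_prop (ground \<sigma>) \<phi>) = sat \<sigma> \<phi>"
  by (rule sat_subst) (auto simp: ground_nth)

lemma true_prop_iff: "true_prop \<phi> \<longleftrightarrow> sat [] \<phi>"
  by (simp add: entails_def)

lemma sat_all_eq:
  "length es = length es' \<Longrightarrow> sat \<rho> (all_eq es es') \<longleftrightarrow> map (eval \<rho>) es = map (eval \<rho>) es'"
  by (induction es es' rule: list_induct2) (auto simp: all_eq_def)

lemma sat_all_nonneg: "sat \<rho> (all_nonneg es) \<longleftrightarrow> (\<forall>e\<in>set es. eval \<rho> e \<ge> 0)"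
  by (induction es) (auto simp: all_nonneg_def)

lemma sat_exns: "sat \<rho> (exns k \<phi>) \<longleftrightarrow> (\<exists>\<tau>. length \<tau> = k \<and> sat (\<tau> @ \<rho>) \<phi>)"
proof (induction k arbitrary: \<rho>)
  case 0
  then show ?case by (simp add: exns_def)
next
  case (Suc k)
  \<comment> \<open>The witness of the outermost quantifier enters the environment first and so ends
    up behind the others.\<close>
  have "sat \<rho> (exns (Suc k) \<phi>) \<longleftrightarrow> (\<exists>i \<tau>. length \<tau> = k \<and> sat ((\<tau> @ [i]) @ \<rho>) \<phi>)"
    using Suc by (simp add: exns_def)
  also have "\<dots> \<longleftrightarrow> (\<exists>\<tau>. length \<tau> = Suc k \<and> sat (\<tau> @ \<rho>) \<phi>)"
    by (metis length_Suc_conv_rev length_append_singleton)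
  finally show ?case .
qed

section \<open>Validity\<close>

lemma fmdom_eq_empty_iff: "fmdom f = {||} \<longleftrightarrow> f = fmempty"
  by (metis fempty_iff fmap_ext fmdom_empty fmdom_notD)

lemma fmmap_eq_fmempty_iff [simp]: "fmmap h f = fmempty \<longleftrightarrow> f = fmempty"
  by (metis fmdom_map fmdom_eq_empty_iff)

inductive_cases valid_plusE: "valid_tp \<Sigma> n C (Plus f)"
inductive_cases valid_withE: "valid_tp \<Sigma> n C (With f)"
inductive_cases valid_tensorE: "valid_tp \<Sigma> n C (Tensor A B)"
inductive_cases valid_lolliE: "valid_tp \<Sigma> n C (Lolli A B)"
inductive_cases valid_questE: "valid_tp \<Sigma> n C (Quest \<phi> A)"
inductive_cases valid_bangE: "valid_tp \<Sigma> n C (Bang \<phi> A)"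
inductive_cases valid_exE: "valid_tp \<Sigma> n C (TEx A)"
inductive_cases valid_allE: "valid_tp \<Sigma> n C (TAll A)"
inductive_cases valid_nameE: "valid_tp \<Sigma> n C (Name V es)"

lemma valid_signatureD:
  assumes "valid_signature \<Sigma>" "(V, k, \<phi>, A) \<in> set \<Sigma>"
  shows "prop_over k \<phi>" "\<nexists>V' es. A = Name V' es" "valid_tp \<Sigma> k \<phi> A" "map_of \<Sigma> V = Some (k, \<phi>, A)"
  using assms by (auto simp: valid_signature_def)

text \<open>The substitution is read as a map from environments satisfying \<open>D\<close> to
  environments satisfying \<open>C\<close>. That the values of \<open>\<theta>\<close> must be
  natural numbers is where the admissibility of index expressions enters.\<close>

definition refines :: "nat \<Rightarrow> aprop \<Rightarrow> (nat \<Rightarrow> aexp) \<Rightarrow> nat \<Rightarrow> aprop \<Rightarrow> bool" where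
  "refines m D \<theta> n C \<longleftrightarrow> (\<forall>\<rho>. length \<rho> = m \<longrightarrow> sat \<rho> D \<longrightarrow>
     (\<exists>\<rho>'. length \<rho>' = n \<and> (\<forall>j<n. eval \<rho> (\<theta> j) = int (\<rho>' ! j)) \<and> sat \<rho>' C))"

lemma refines_Conj:
  assumes "refines m D \<theta> n C" "prop_over n \<phi>"
  shows "refines m (Conj D (subst_prop \<theta> \<phi>)) \<theta> n (Conj C \<phi>)"
  unfolding refines_def
proof (intro allI impI)
  fix \<rho> assume *: "length \<rho> = m" "sat \<rho> (Conj D (subst_prop \<theta> \<phi>))"
  then obtain \<rho>' where \<rho>': "length \<rho>' = n" "\<forall>j<n. eval \<rho> (\<theta> j) = int (\<rho>' ! j)" "sat \<rho>' C"
    using assms(1) by (auto simp: refines_def)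
  moreover have "sat \<rho>' \<phi>"
    using * \<rho>' sat_subst[OF assms(2), of \<rho> \<theta> \<rho>'] by simp
  ultimately show "\<exists>\<rho>'. length \<rho>' = n \<and> (\<forall>j<n. eval \<rho> (\<theta> j) = int (\<rho>' ! j)) \<and> sat \<rho>' (Conj C \<phi>)"
    by auto
qed

lemma refines_under_binder:
  assumes "refines m D \<theta> n C" "prop_over m D" "prop_over n C"
  shows "refines (Suc m) (shift_prop 1 D) (under_binder \<theta>) (Suc n) (shift_prop 1 C)"
  unfolding refines_def
proof (intro allI impI)
  fix \<rho> assume *: "length \<rho> = Suc m" "sat \<rho> (shift_prop 1 D)"
  then obtain i \<rho>0 where \<rho>: "\<rho> = i # \<rho>0" by (cases \<rho>) auto
  with * assms obtain \<rho>' where \<rho>': "length \<rho>' = n" "\<forall>j<n. eval \<rho>0 (\<theta> j) = int (\<rho>' ! j)" "sat \<rho>' C"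
    by (auto simp: refines_def sat_shift[OF assms(2), simplified])
  have "eval \<rho> (under_binder \<theta> j) = int ((i # \<rho>') ! j)" if "j < Suc n" for j
    using eval_under_binder_cong[of n \<rho>0 \<theta> \<rho>' Var j i] \<rho>' that by (simp add: \<rho>)
  then show "\<exists>\<rho>'. length \<rho>' = Suc n \<and> (\<forall>j<Suc n. eval \<rho> (under_binder \<theta> j) = int (\<rho>' ! j)) \<and>
      sat \<rho>' (shift_prop 1 C)"
    using \<rho>' sat_shift[OF assms(3), of i \<rho>'] by (intro exI[of _ "i # \<rho>'"]) auto
qed

text \<open>Strengthening a constraint, grounding a context and instantiating the body of a
  definition are all instances of this, with \<open>Var\<close>, \<open>ground\<close> and
  \<open>inst\<close> for \<open>\<theta>\<close>.\<close>

lemma valid_subst: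
  assumes "valid_signature \<Sigma>"
  shows "valid_tp \<Sigma> n C A \<Longrightarrow> prop_over n C \<Longrightarrow> prop_over m D
    \<Longrightarrow> (\<And>j. j < n \<Longrightarrow> exp_over m (\<theta> j)) \<Longrightarrow> refines m D \<theta> n C
    \<Longrightarrow> valid_tp \<Sigma> m D (subst_tp A \<theta>)"
proof (induction arbitrary: m D \<theta> rule: valid_tp.induct)
  case (plus f n C)
  then show ?case by (auto intro!: valid_tp.plus)
next
  case ("with" f n C)
  then show ?case by (auto intro!: valid_tp.with)
next
  case (tensor n C A B)
  then show ?case by (auto intro!: valid_tp.tensor)
next
  case (lolli n C A B)
  then show ?case by (auto intro!: valid_tp.lolli)
next
  case (one n C)
  then show ?case by (auto intro!: valid_tp.one)
next
  case (quest n \<phi> C A)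
  have \<phi>: "prop_over m (subst_prop \<theta> \<phi>)" using quest.hyps(1) quest.prems(3) by (rule prop_over_subst)
  show ?case unfolding subst_tp.simps using \<phi> quest.hyps(1) quest.prems
    by (intro valid_tp.quest quest.IH refines_Conj) auto
next
  case (bang n \<phi> C A)
  have \<phi>: "prop_over m (subst_prop \<theta> \<phi>)" using bang.hyps(1) bang.prems(3) by (rule prop_over_subst)
  show ?case unfolding subst_tp.simps using \<phi> bang.hyps(1) bang.prems
    by (intro valid_tp.bang bang.IH refines_Conj) auto
next
  case (ex n C A)
  show ?case unfolding subst_tp.simps using ex.prems
    by (intro valid_tp.ex ex.IH refines_under_binder prop_over_shift exp_over_under_binder[where n = n])
next
  case (all n C A)
  show ?case unfolding subst_tp.simps using all.prems
    by (intro valid_tp.all all.IH refines_under_binder prop_over_shift exp_over_under_binder[where n = n])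
next
  case (name V k \<phi> A es n C)
  have "sat \<rho> (all_nonneg (map (subst_exp \<theta>) es)) \<and>
        sat \<rho> (subst_prop (inst (map (subst_exp \<theta>) es)) \<phi>)"
    if *: "length \<rho> = m" "sat \<rho> D" for \<rho>
  proof -
    \<comment> \<open>The environment is carried back to the original context, where the index
      expressions have the same values and both entailments of rule \<open>name\<close> are
      known.\<close>
    obtain \<rho>' where \<rho>': "length \<rho>' = n" "\<forall>j<n. eval \<rho> (\<theta> j) = int (\<rho>' ! j)" "sat \<rho>' C"
      using * name.prems by (auto simp: refines_def)
    have ev: "eval \<rho> (subst_exp \<theta> e) = eval \<rho>' e" if "e \<in> set es" for e
      using \<rho>' that name.hyps by (auto intro: eval_subst)
    have "sat \<rho>' (all_nonneg es)" and s: "sat \<rho>' (subst_prop (inst es) \<phi>)"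
      using \<rho>' name.hyps by (auto simp: entails_def)
    moreover have "sat \<rho> (subst_prop (inst (map (subst_exp \<theta>) es)) \<phi>) = sat \<rho>' (subst_prop (inst es) \<phi>)"
      using valid_signatureD(1)[OF assms name.hyps(1)] name.hyps(2)
      by (auto intro!: sat_subst_cong simp: inst_def ev)
    ultimately show ?thesis by (auto simp: sat_all_nonneg ev)
  qed
  with name show ?case
    by (auto intro!: valid_tp.name exp_over_subst[of n] simp: entails_def)
qed

lemma subst_tp_Var [simp]: "subst_tp A Var = A"
proof (induction A)
  case (Plus f)
  then show ?case by (auto intro!: trans[OF fmap.map_cong0 fmap.map_ident])
next
  case (With f)
  then show ?case by (auto intro!: trans[OF fmap.map_cong0 fmap.map_ident])
qed (simp_all add: map_idI)

lemma valid_weaken: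
  assumes "valid_signature \<Sigma>" "valid_tp \<Sigma> n C A" "prop_over n C" "prop_over n D" "entails n D C"
  shows "valid_tp \<Sigma> n D A"
  using valid_subst[OF assms(1-4), of Var] assms(5) by (auto simp: refines_def entails_def)

lemma valid_ground:
  assumes "valid_signature \<Sigma>" "valid_tp \<Sigma> n C A" "prop_over n C" "length \<sigma> = n" "sat \<sigma> C"
  shows "closed_valid \<Sigma> (subst_tp A (ground \<sigma>))"
  using assms(4,5)
  by (intro valid_subst[OF assms(1-3)]) (auto simp: refines_def ground_nth intro: exI[of _ \<sigma>])

lemma valid_body:
  assumes "valid_signature \<Sigma>" "valid_tp \<Sigma> n C (Name V es)" "prop_over n C" "(V, k, \<phi>, A) \<in> set \<Sigma>"
  shows "valid_tp \<Sigma> n C (subst_tp A (inst es))"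
proof -
  note sig = valid_signatureD[OF assms(1)]
  have *: "length es = k" "\<forall>e\<in>set es. exp_over n e" "entails n C (all_nonneg es)"
    "entails n C (subst_prop (inst es) \<phi>)"
    \<comment> \<open>Type names are distinct, so the definition that makes the name valid is the
      given one.\<close>
    using assms(2) sig(4)[OF assms(4)] sig(4) by (auto elim!: valid_nameE)+
  have "refines n C (inst es) k \<phi>"
    unfolding refines_def
  proof (intro allI impI)
    fix \<rho> assume \<rho>: "length \<rho> = n" "sat \<rho> C"
    \<comment> \<open>\<open>nat\<close> loses nothing: the first entailment in rule
      \<open>name\<close> makes these values non-negative, so they form an environment for the
      parameters.\<close>
    have nth: "eval \<rho> (inst es j) = int (map (\<lambda>e. nat (eval \<rho> e)) es ! j)" if "j < k" for j
      using that * \<rho> by (auto simp: entails_def inst_def sat_all_nonneg)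
    have "sat \<rho> (subst_prop (inst es) \<phi>)" using * \<rho> by (auto simp: entails_def)
    then show "\<exists>\<rho>'. length \<rho>' = k \<and> (\<forall>j<k. eval \<rho> (inst es j) = int (\<rho>' ! j)) \<and> sat \<rho>' \<phi>"
      using sat_subst[OF sig(1)[OF assms(4)] nth] nth *(1)
      by (intro exI[of _ "map (\<lambda>e. nat (eval \<rho> e)) es"]) auto
  qed
  then show ?thesis
    using * by (intro valid_subst[OF assms(1) sig(3)[OF assms(4)] sig(1)[OF assms(4)] assms(3)])
      (auto simp: inst_def)
qed

lemma valid_unfold:
  assumes "valid_signature \<Sigma>" "closed_valid \<Sigma> A"
  shows "closed_valid \<Sigma> (unfold \<Sigma> A)"
  using assms(2) valid_body[OF assms(1)]
  by (auto simp: unfold_def split: tp.splits option.splits dest: map_of_SomeD)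

text \<open>The two substitutions differ beyond the parameters, but a valid body has no other free
  variables.\<close>

lemma subst_body:
  assumes "valid_tp \<Sigma> (length es) \<phi> A"
  shows "subst_tp (subst_tp A (inst es)) \<theta> = subst_tp A (inst (map (subst_exp \<theta>) es))"
  unfolding subst_tp_subst using assms by (rule subst_tp_cong) (simp add: inst_def)

section \<open>Values of closed expressions\<close>

lemma exp_over_0_subst: "exp_over 0 e \<Longrightarrow> subst_exp \<theta> e = e"
  by (induction e) auto

lemma exp_over_0_imp: "exp_over 0 e \<Longrightarrow> exp_over n e"
  by (induction e) auto

lemma exp_over_val [simp]: "exp_over n (val_exp e) = exp_over n e"
  by (induction e) (auto simp: val_of_def intro: exp_over_0_imp)

lemma eval_closed: "exp_over 0 e \<Longrightarrow> eval \<rho> e = eval [] e"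
  by (induction e) auto

lemma eval_val [simp]: "eval \<rho> (val_exp e) = eval \<rho> e"
  by (induction e) (auto simp: val_of_def dest!: eval_closed[of _ \<rho>])

lemma prop_over_val [simp]: "prop_over n (val_prop \<phi>) = prop_over n \<phi>"
  by (induction \<phi> arbitrary: n) auto

lemma sat_val [simp]: "sat \<rho> (val_prop \<phi>) = sat \<rho> \<phi>"
  by (induction \<phi> arbitrary: \<rho>) auto

lemma val_exp_closed: "exp_over 0 e \<Longrightarrow> val_exp e = Const (eval [] e)"
  by (cases e) (auto simp: val_of_def)

text \<open>\<open>val_exp\<close> collapses only closed subexpressions, which substitution leaves
  alone. An open expression may become closed by the substitution; then both sides collapse to the
  same value.\<close>

lemma val_exp_subst: "val_exp (subst_exp \<theta> (val_exp e)) = val_exp (subst_exp \<theta> e)"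
proof (cases "exp_over 0 e")
  case True
  then show ?thesis by (simp add: val_exp_closed exp_over_0_subst)
next
  case False
  then show ?thesis
  proof (induction e)
    case (Add e e')
    \<comment> \<open>The induction hypothesis covers open operands only, but one operand of an open
      sum may be closed.\<close>
    have "val_exp (subst_exp \<theta> (val_exp a)) = val_exp (subst_exp \<theta> a)" if "a \<in> {e, e'}" for a
      using Add.IH that by (cases "exp_over 0 a") (auto simp: val_exp_closed exp_over_0_subst)
    then show ?case using Add.prems
      by (simp add: val_of_def) (metis eval_val exp_over_val insertCI)
  next
    case (Sub e e')
    have "val_exp (subst_exp \<theta> (val_exp a)) = val_exp (subst_exp \<theta> a)" if "a \<in> {e, e'}" for a
      using Sub.IH that by (cases "exp_over 0 a") (auto simp: val_exp_closed exp_over_0_subst)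
    then show ?case using Sub.prems
      by (simp add: val_of_def) (metis eval_val exp_over_val insertCI)
  next
    case (Mul i e)
    then show ?case by (simp add: val_of_def) (metis eval_val exp_over_val)
  qed auto
qed

lemma val_exp_subst_cong:
  assumes "\<And>j. val_exp (\<theta> j) = val_exp (\<theta>' j)"
  shows "val_exp (subst_exp \<theta> e) = val_exp (subst_exp \<theta>' e)"
proof -
  \<comment> \<open>\<open>val_of\<close> branches on closedness and then returns the value, so both
    must agree for the two instances.\<close>
  have over: "exp_over 0 (subst_exp \<theta> a) = exp_over 0 (subst_exp \<theta>' a)" for a
  proof (induction a)
    case (Var j)
    then show ?case using assms[of j] by (metis exp_over_val subst_exp.simps(2))
  qed auto
  have ev: "eval [] (subst_exp \<theta> a) = eval [] (subst_exp \<theta>' a)" for a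
  proof (induction a)
    case (Var j)
    then show ?case using assms[of j] by (metis eval_val subst_exp.simps(2))
  qed auto
  show ?thesis
    by (induction e) (auto simp: val_of_def over ev assms)
qed

lemma val_under_binder_cong:
  assumes "\<And>j. val_exp (\<theta> j) = val_exp (\<theta>' j)"
  shows "val_exp (under_binder \<theta> j) = val_exp (under_binder \<theta>' j)"
proof (cases j)
  case (Suc i)
  then show ?thesis using arg_cong[OF assms[of i], of "\<lambda>e. val_exp (shift_exp 1 e)"]
    by (simp add: val_exp_subst)
qed simp

lemma val_prop_subst: "val_prop (subst_prop \<theta> (val_prop \<phi>)) = val_prop (subst_prop \<theta> \<phi>)"
  by (induction \<phi> arbitrary: \<theta>) (auto simp: val_exp_subst)

lemma val_prop_subst_cong:
  "(\<And>j. val_exp (\<theta> j) = val_exp (\<theta>' j))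
    \<Longrightarrow> val_prop (subst_prop \<theta> \<phi>) = val_prop (subst_prop \<theta>' \<phi>)"
proof (induction \<phi> arbitrary: \<theta> \<theta>')
  case (Exn \<phi>)
  show ?case by (simp, rule Exn.IH, rule val_under_binder_cong, rule Exn.prems)
next
  case (Alln \<phi>)
  show ?case by (simp, rule Alln.IH, rule val_under_binder_cong, rule Alln.prems)
next
  case (Conj \<phi> \<psi>)
  show ?case using Conj.IH[OF Conj.prems] by simp
next
  case (Disj \<phi> \<psi>)
  show ?case using Disj.IH[OF Disj.prems] by simp
next
  case (Neg \<phi>)
  show ?case using Neg.IH[OF Neg.prems] by simp
next
  case (Eq e e')
  show ?case using val_exp_subst_cong[OF Eq.prems] by simp
next
  case (Gt e e')
  show ?case using val_exp_subst_cong[OF Gt.prems] by simp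
next
  case (Dvd i e)
  show ?case using val_exp_subst_cong[OF Dvd.prems] by simp
qed simp_all

lemma val_tp_subst: "val_tp (subst_tp (val_tp A) \<theta>) = val_tp (subst_tp A \<theta>)"
proof (induction A arbitrary: \<theta>)
  case (Plus f)
  then show ?case by (auto simp: fmap.map_comp intro!: fmap.map_cong0)
next
  case (With f)
  then show ?case by (auto simp: fmap.map_comp intro!: fmap.map_cong0)
qed (auto simp: val_exp_subst val_prop_subst)

lemma val_tp_subst_cong:
  "(\<And>j. val_exp (\<theta> j) = val_exp (\<theta>' j))
    \<Longrightarrow> val_tp (subst_tp A \<theta>) = val_tp (subst_tp A \<theta>')"
proof (induction A arbitrary: \<theta> \<theta>')
  case (Plus f)
  show ?case using Plus.IH[OF _ Plus.prems] by (auto simp: fmap.map_comp intro!: fmap.map_cong0)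
next
  case (With f)
  show ?case using With.IH[OF _ With.prems] by (auto simp: fmap.map_comp intro!: fmap.map_cong0)
next
  case (TEx A)
  show ?case by (simp, rule TEx.IH, rule val_under_binder_cong, rule TEx.prems)
next
  case (TAll A)
  show ?case by (simp, rule TAll.IH, rule val_under_binder_cong, rule TAll.prems)
next
  case (Tensor A B)
  show ?case using Tensor.IH[OF Tensor.prems] by simp
next
  case (Lolli A B)
  show ?case using Lolli.IH[OF Lolli.prems] by simp
next
  case (Quest \<phi> A)
  show ?case using Quest.IH[OF Quest.prems] val_prop_subst_cong[OF Quest.prems] by simp
next
  case (Bang \<phi> A)
  show ?case using Bang.IH[OF Bang.prems] val_prop_subst_cong[OF Bang.prems] by simp
next
  case (Name V es)
  show ?case using val_exp_subst_cong[OF Name.prems] by simp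
qed simp

lemma val_tp_subst_eq:
  "val_tp A = val_tp A' \<Longrightarrow> val_tp (subst_tp A \<theta>) = val_tp (subst_tp A' \<theta>)"
  by (metis val_tp_subst)

lemma map_val_exp_eqD:
  assumes "map val_exp es = map val_exp es'"
  shows "length es = length es'" "map (eval \<rho>) es = map (eval \<rho>) es'"
    "(\<forall>e\<in>set es. exp_over n e) = (\<forall>e\<in>set es'. exp_over n e)"
    "val_exp (inst es j) = val_exp (inst es' j)"
proof -
  show l: "length es = length es'" using assms by (rule map_eq_imp_length_eq)
  show "map (eval \<rho>) es = map (eval \<rho>) es'"
    using arg_cong[OF assms, of "map (eval \<rho>)"] by (simp add: comp_def)
  show "(\<forall>e\<in>set es. exp_over n e) = (\<forall>e\<in>set es'. exp_over n e)"
    using arg_cong[OF assms, of "\<lambda>xs. \<forall>x\<in>set xs. exp_over n x"] by simp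
  show "val_exp (inst es j) = val_exp (inst es' j)"
    using l arg_cong[OF assms, of "\<lambda>xs. xs ! j"] by (auto simp: inst_def)
qed

lemma val_tp_unfold:
  assumes "val_tp A = val_tp A'"
  shows "val_tp (unfold \<Sigma> A) = val_tp (unfold \<Sigma> A')"
proof (cases "\<exists>V es. A = Name V es")
  case True
  then obtain V es es' where A: "A = Name V es" "A' = Name V es'" and es: "map val_exp es = map val_exp es'"
    using assms by (cases A') auto
  show ?thesis
    using assms by (auto simp: A unfold_def split: option.splits
        intro!: val_tp_subst_cong map_val_exp_eqD(4)[OF es])
next
  case False
  moreover have "\<nexists>V es. A' = Name V es" using False assms by (cases A) auto
  ultimately have "unfold \<Sigma> A = A" "unfold \<Sigma> A' = A'"
    by (auto simp: unfold_def split: tp.splits)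
  then show ?thesis using assms by simp
qed

lemma fmmap_eqD:
  assumes "fmmap h f = fmmap h g"
  shows "fmrel (\<lambda>a b. h a = h b) f g"
proof -
  have "fmrel (=) (fmmap h f) (fmmap h g)" using assms by (simp add: fmap.rel_eq)
  then show ?thesis by (simp add: fmap.rel_map)
qed

text \<open>A type bisimulation contains closed valid types only and is closed under equality of
  values; this makes the two demands compatible.\<close>

lemma valid_val:
  assumes "valid_signature \<Sigma>"
  shows "valid_tp \<Sigma> n C A \<Longrightarrow> prop_over n C \<Longrightarrow> val_tp A' = val_tp A \<Longrightarrow> valid_tp \<Sigma> n C A'"
proof (induction arbitrary: A' rule: valid_tp.induct)
  case (plus f n C)
  then obtain g where g: "A' = Plus g" "fmmap val_tp g = fmmap val_tp f" by (cases A') auto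
  have rel: "fmrel (\<lambda>a b. val_tp a = val_tp b) g f" using g(2) by (rule fmmap_eqD)
  have "g \<noteq> fmempty" using g(2) plus.hyps(1) by (metis fmmap_eq_fmempty_iff)
  moreover have "valid_tp \<Sigma> n C B" if "fmlookup g l = Some B" for l B
    using rel plus.IH plus.prems(1) that by (auto simp: fmrel_iff option_rel_Some1 dest!: spec[of _ l])
  ultimately show ?case unfolding g(1) by (rule valid_tp.plus)
next
  case ("with" f n C)
  then obtain g where g: "A' = With g" "fmmap val_tp g = fmmap val_tp f" by (cases A') auto
  have rel: "fmrel (\<lambda>a b. val_tp a = val_tp b) g f" using g(2) by (rule fmmap_eqD)
  have "g \<noteq> fmempty" using g(2) "with.hyps"(1) by (metis fmmap_eq_fmempty_iff)
  moreover have "valid_tp \<Sigma> n C B" if "fmlookup g l = Some B" for l B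
    using rel "with.IH" "with.prems"(1) that by (auto simp: fmrel_iff option_rel_Some1 dest!: spec[of _ l])
  ultimately show ?case unfolding g(1) by (rule valid_tp.with)
next
  case (tensor n C A B)
  then show ?case by (cases A') (auto intro: valid_tp.tensor)
next
  case (lolli n C A B)
  then show ?case by (cases A') (auto intro: valid_tp.lolli)
next
  case (one n C)
  then show ?case by (cases A') (auto intro: valid_tp.one)
next
  case (quest n \<phi> C A)
  then obtain \<psi> B where B: "A' = Quest \<psi> B" "val_prop \<psi> = val_prop \<phi>" "val_tp B = val_tp A"
    by (cases A') auto
  have "prop_over n \<psi>" "\<And>\<rho>. sat \<rho> \<psi> = sat \<rho> \<phi>" using B(2) quest.hyps(1) by (metis prop_over_val sat_val)+
  \<comment> \<open>The induction hypothesis speaks of the constraint extended by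
    \<open>\<phi>\<close>, the rule of the one extended by \<open>\<psi>\<close>. The two are
    equivalent, which suffices by \<open>valid_weaken\<close>.\<close>
  then show ?case using quest.hyps(1) quest.IH[OF _ B(3)] quest.prems(1) unfolding B(1)
    by (auto intro!: valid_tp.quest intro: valid_weaken[OF assms] simp: entails_def)
next
  case (bang n \<phi> C A)
  then obtain \<psi> B where B: "A' = Bang \<psi> B" "val_prop \<psi> = val_prop \<phi>" "val_tp B = val_tp A"
    by (cases A') auto
  have "prop_over n \<psi>" "\<And>\<rho>. sat \<rho> \<psi> = sat \<rho> \<phi>" using B(2) bang.hyps(1) by (metis prop_over_val sat_val)+
  then show ?case using bang.hyps(1) bang.IH[OF _ B(3)] bang.prems(1) unfolding B(1)
    by (auto intro!: valid_tp.bang intro: valid_weaken[OF assms] simp: entails_def)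
next
  case (ex n C A)
  then show ?case using prop_over_shift[OF ex.prems(1)] by (cases A') (auto intro: valid_tp.ex)
next
  case (all n C A)
  then show ?case using prop_over_shift[OF all.prems(1)] by (cases A') (auto intro: valid_tp.all)
next
  case (name V k \<phi> A es n C)
  then obtain es' where A': "A' = Name V es'" and es: "map val_exp es' = map val_exp es"
    by (cases A') auto
  have "(\<forall>e\<in>set es'. eval \<rho> e \<ge> 0) = (\<forall>e\<in>set es. eval \<rho> e \<ge> 0)" for \<rho>
    using arg_cong[OF map_val_exp_eqD(2)[OF es, of \<rho>], of "\<lambda>xs. \<forall>x\<in>set xs. x \<ge> 0"] by simp
  moreover have "sat \<rho> (subst_prop (inst es') \<phi>) = sat \<rho> (subst_prop (inst es) \<phi>)" for \<rho>
    using arg_cong[OF val_prop_subst_cong[of "inst es'" "inst es" \<phi>, OF map_val_exp_eqD(4)[OF es]], of "sat \<rho>"]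
    by simp
  ultimately show ?case unfolding A' using name.hyps map_val_exp_eqD(1,3)[OF es]
    by (intro valid_tp.name[OF name.hyps(1)]) (auto simp: entails_def sat_all_nonneg)
qed

section \<open>Approximations of type bisimilarity\<close>

text \<open>Iterates, from the full relation downwards, of the operator behind type bisimulations.
  Unfolding costs no level; only a step to the components does.\<close>

primrec approx :: "('l, 'v) signature \<Rightarrow> nat \<Rightarrow> ('l, 'v) tp rel" where
  "approx \<Sigma> 0 = UNIV"
| "approx \<Sigma> (Suc k) = {(A, B). bisim_step (approx \<Sigma> k) (unfold \<Sigma> A) (unfold \<Sigma> B)}"

lemma bisim_step_mono:
  assumes "R \<subseteq> R'" "bisim_step R S T"
  shows "bisim_step R' S T"
proof -
  have "fmrel (\<lambda>A B. (A, B) \<in> R') f g" if "fmrel (\<lambda>A B. (A, B) \<in> R) f g" for f g :: "('c, _) fmap"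
    using that assms(1) by (auto elim!: fmap.rel_mono_strong)
  with assms show ?thesis by (cases S) (auto 0 3)
qed

lemma approx_Suc_subset: "approx \<Sigma> (Suc k) \<subseteq> approx \<Sigma> k"
proof (induction k)
  case (Suc k)
  then show ?case by (auto intro: bisim_step_mono)
qed simp

lemma approx_antimono: "j \<le> k \<Longrightarrow> approx \<Sigma> k \<subseteq> approx \<Sigma> j"
  using approx_Suc_subset by (rule lift_Suc_antimono_le)

lemma approx_refl: "(A, A) \<in> approx \<Sigma> k"
proof (induction k arbitrary: A)
  case (Suc k)
  \<comment> \<open>For a guarded type, either the proposition or its negation is true in the empty
    environment, which selects the disjunct.\<close>
  have "bisim_step (approx \<Sigma> k) S S" for S
    using Suc by (cases S) (auto intro: fmap.rel_refl simp: true_prop_iff)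
  then show ?case by simp
qed simp

lemma bisim_step_val:
  assumes R: "\<And>A B A' B'. (A, B) \<in> R \<Longrightarrow> val_tp A' = val_tp A \<Longrightarrow> val_tp B' = val_tp B \<Longrightarrow> (A', B') \<in> R"
    and "bisim_step R S T" "val_tp S' = val_tp S" "val_tp T' = val_tp T"
  shows "bisim_step R S' T'"
proof -
  have fm: "fmrel (\<lambda>A B. (A, B) \<in> R) f' g'"
    if "fmrel (\<lambda>A B. (A, B) \<in> R) f g" "fmmap val_tp f' = fmmap val_tp f" "fmmap val_tp g' = fmmap val_tp g"
    for f g f' g' :: "('a, ('a, 'b) tp) fmap"
  proof -
    have "fmrel (\<lambda>A B. val_tp A = val_tp B) f' f" "fmrel (\<lambda>A B. val_tp A = val_tp B) g g'"
      using that fmmap_eqD by metis+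
    \<comment> \<open>The given relation is put between two changes of representative, which
      \<open>R\<close> absorbs.\<close>
    then have "fmrel ((\<lambda>A B. val_tp A = val_tp B) OO (\<lambda>A B. (A, B) \<in> R) OO (\<lambda>A B. val_tp A = val_tp B)) f' g'"
      using that(1) by (auto simp: fmap.rel_compp)
    then show ?thesis by (rule fmap.rel_mono_strong) (elim relcomppE, rule R, assumption, simp_all)
  qed
  have P: "true_prop \<phi>' \<and> true_prop \<psi>' \<and> (A', B') \<in> R \<or> true_prop (Neg \<phi>') \<and> true_prop (Neg \<psi>')"
    if "true_prop \<phi> \<and> true_prop \<psi> \<and> (A, B) \<in> R \<or> true_prop (Neg \<phi>) \<and> true_prop (Neg \<psi>)"
      "val_prop \<phi>' = val_prop \<phi>" "val_prop \<psi>' = val_prop \<psi>" "val_tp A' = val_tp A" "val_tp B' = val_tp B"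
    for \<phi> \<psi> A B \<phi>' \<psi>' A' B'
  proof -
    have "sat [] \<phi>' = sat [] \<phi>" "sat [] \<psi>' = sat [] \<psi>"
      using that(2,3) by (metis sat_val)+
    then show ?thesis using that(1) R[OF _ that(4,5)] by (auto simp: true_prop_iff)
  qed
  have Q: "(subst_tp A' (ground [i]), subst_tp B' (ground [i])) \<in> R"
    if "\<forall>i. (subst_tp A (ground [i]), subst_tp B (ground [i])) \<in> R" "val_tp A' = val_tp A" "val_tp B' = val_tp B"
    for A B A' B' i
    using that by (blast intro: R val_tp_subst_eq)
  show ?thesis
  proof (cases S)
    case (Plus f)
    with assms(2-) show ?thesis by (cases S'; cases T') (auto intro: fm)
  next
    case (With f)
    with assms(2-) show ?thesis by (cases S'; cases T') (auto intro: fm)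
  next
    case (Tensor A B)
    with assms(2-) show ?thesis by (cases S'; cases T') (auto elim: R)
  next
    case (Lolli A B)
    with assms(2-) show ?thesis by (cases S'; cases T') (auto elim: R)
  next
    case One
    with assms(2-) show ?thesis by (cases S'; cases T') auto
  next
    case (Quest \<phi> A)
    then obtain \<psi> B where T: "T = Quest \<psi> B"
      and step: "true_prop \<phi> \<and> true_prop \<psi> \<and> (A, B) \<in> R \<or> true_prop (Neg \<phi>) \<and> true_prop (Neg \<psi>)"
      using assms(2) by auto
    obtain \<phi>' A' where S': "S' = Quest \<phi>' A'" "val_prop \<phi>' = val_prop \<phi>" "val_tp A' = val_tp A"
      using assms(3) Quest by (cases S') auto
    obtain \<psi>' B' where T': "T' = Quest \<psi>' B'" "val_prop \<psi>' = val_prop \<psi>" "val_tp B' = val_tp B"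
      using assms(4) T by (cases T') auto
    show ?thesis using P[OF step S'(2) T'(2) S'(3) T'(3)] by (simp add: S'(1) T'(1))
  next
    case (Bang \<phi> A)
    then obtain \<psi> B where T: "T = Bang \<psi> B"
      and step: "true_prop \<phi> \<and> true_prop \<psi> \<and> (A, B) \<in> R \<or> true_prop (Neg \<phi>) \<and> true_prop (Neg \<psi>)"
      using assms(2) by auto
    obtain \<phi>' A' where S': "S' = Bang \<phi>' A'" "val_prop \<phi>' = val_prop \<phi>" "val_tp A' = val_tp A"
      using assms(3) Bang by (cases S') auto
    obtain \<psi>' B' where T': "T' = Bang \<psi>' B'" "val_prop \<psi>' = val_prop \<psi>" "val_tp B' = val_tp B"
      using assms(4) T by (cases T') auto
    show ?thesis using P[OF step S'(2) T'(2) S'(3) T'(3)] by (simp add: S'(1) T'(1))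
  next
    case (TEx A)
    with assms(2-) show ?thesis by (cases S'; cases T') (auto elim: Q)
  next
    case (TAll A)
    with assms(2-) show ?thesis by (cases S'; cases T') (auto elim: Q)
  next
    case (Name V es)
    with assms(2-) show ?thesis by (cases S'; cases T') auto
  qed
qed

lemma approx_val:
  "(A, B) \<in> approx \<Sigma> k \<Longrightarrow> val_tp A' = val_tp A \<Longrightarrow> val_tp B' = val_tp B \<Longrightarrow> (A', B') \<in> approx \<Sigma> k"
proof (induction k arbitrary: A B A' B')
  case (Suc k)
  show ?case
    using Suc.prems
    by (auto intro: bisim_step_val[OF Suc.IH _ val_tp_unfold val_tp_unfold])
qed simp

definition bisimilarity :: "('l, 'v) signature \<Rightarrow> ('l, 'v) tp rel" where
  "bisimilarity \<Sigma> = {(A, B). closed_valid \<Sigma> A \<and> closed_valid \<Sigma> B \<and> (\<forall>k. (A, B) \<in> approx \<Sigma> k)}"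

text \<open>Each clause of \<^const>\<open>bisim_step\<close> determines its witnesses, so it commutes with the
  intersection of the approximations.\<close>

lemma bisim_step_bisimilarity:
  assumes sig: "valid_signature \<Sigma>" and valid: "closed_valid \<Sigma> S" "closed_valid \<Sigma> T"
    and step: "\<And>k. bisim_step (approx \<Sigma> k) S T"
  shows "bisim_step (bisimilarity \<Sigma>) S T"
proof -
  have fm: "fmrel (\<lambda>A B. (A, B) \<in> bisimilarity \<Sigma>) f g"
    if "\<And>k. fmrel (\<lambda>A B. (A, B) \<in> approx \<Sigma> k) f g"
      "\<And>l A. fmlookup f l = Some A \<Longrightarrow> closed_valid \<Sigma> A" "\<And>l A. fmlookup g l = Some A \<Longrightarrow> closed_valid \<Sigma> A"
    for f g
  proof (rule fmrelI)
    fix l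
    have "rel_option (\<lambda>A B. (A, B) \<in> approx \<Sigma> k) (fmlookup f l) (fmlookup g l)" for k
      using that(1) by (simp add: fmrel_iff)
    then show "rel_option (\<lambda>A B. (A, B) \<in> bisimilarity \<Sigma>) (fmlookup f l) (fmlookup g l)"
      using that(2,3)[of l] by (auto simp: option.rel_sel bisimilarity_def)
  qed
  have guard: "closed_valid \<Sigma> A" if "valid_tp \<Sigma> 0 (Conj Tru \<phi>) A" "true_prop \<phi>" "prop_over 0 \<phi>" for \<phi> A
    using valid_weaken[OF sig that(1)] that by (auto simp: entails_def)
  have inst: "closed_valid \<Sigma> (subst_tp A (ground [i]))" if "valid_tp \<Sigma> (Suc 0) Tru A" for A i
    using valid_ground[OF sig that, of "[i]"] by simp
  show ?thesis
  proof (cases S)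
    case (Plus f)
    \<comment> \<open>Although \<open>approx\<close> is the full relation at level 0, a step into it
      already fixes the outermost constructor of \<open>T\<close>.\<close>
    with step[of 0] obtain g where T: "T = Plus g" by auto
    with step Plus valid show ?thesis by (auto intro!: fm elim!: valid_plusE)
  next
    case (With f)
    with step[of 0] obtain g where T: "T = With g" by auto
    with step With valid show ?thesis by (auto intro!: fm elim!: valid_withE)
  next
    case (Tensor A B)
    with step[of 0] obtain A' B' where T: "T = Tensor A' B'" by auto
    with step Tensor valid show ?thesis by (auto simp: bisimilarity_def elim!: valid_tensorE)
  next
    case (Lolli A B)
    with step[of 0] obtain A' B' where T: "T = Lolli A' B'" by auto
    with step Lolli valid show ?thesis by (auto simp: bisimilarity_def elim!: valid_lolliE)
  next
    case One
    with step show ?thesis by simp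
  next
    case (Quest \<phi> A)
    with step[of 0] obtain \<psi> B where T: "T = Quest \<psi> B" by auto
    with step Quest valid show ?thesis
      by (auto simp: bisimilarity_def true_prop_iff guard[unfolded true_prop_iff] elim!: valid_questE)
  next
    case (Bang \<phi> A)
    with step[of 0] obtain \<psi> B where T: "T = Bang \<psi> B" by auto
    with step Bang valid show ?thesis
      by (auto simp: bisimilarity_def true_prop_iff guard[unfolded true_prop_iff] elim!: valid_bangE)
  next
    case (TEx A)
    with step[of 0] obtain B where T: "T = TEx B" by auto
    with step TEx valid show ?thesis by (auto simp: bisimilarity_def inst elim!: valid_exE)
  next
    case (TAll A)
    with step[of 0] obtain B where T: "T = TAll B" by auto
    with step TAll valid show ?thesis by (auto simp: bisimilarity_def inst elim!: valid_allE)
  next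
    case (Name V es)
    then show ?thesis by simp
  qed
qed

lemma type_bisimulation_bisimilarity:
  assumes "valid_signature \<Sigma>"
  shows "type_bisimulation \<Sigma> (bisimilarity \<Sigma>)"
  unfolding type_bisimulation_def
proof (intro conjI)
  show "\<forall>(A, B)\<in>bisimilarity \<Sigma>. closed_valid \<Sigma> A \<and> closed_valid \<Sigma> B"
    by (auto simp: bisimilarity_def)
  show "\<forall>(A, B)\<in>bisimilarity \<Sigma>. \<forall>A' B'. val_tp A' = val_tp A \<longrightarrow> val_tp B' = val_tp B \<longrightarrow>
      (A', B') \<in> bisimilarity \<Sigma>"
    by (auto simp: bisimilarity_def intro: approx_val valid_val[OF assms])
  have "bisim_step (bisimilarity \<Sigma>) (unfold \<Sigma> A) (unfold \<Sigma> B)" if "(A, B) \<in> bisimilarity \<Sigma>" for A B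
  proof (rule bisim_step_bisimilarity[OF assms])
    show "bisim_step (approx \<Sigma> k) (unfold \<Sigma> A) (unfold \<Sigma> B)" for k
      using that by (auto simp: bisimilarity_def dest: spec[of _ "Suc k"])
  qed (use that in \<open>auto simp: bisimilarity_def intro: valid_unfold[OF assms]\<close>)
  then show "\<forall>(A, B)\<in>bisimilarity \<Sigma>. bisim_step (bisimilarity \<Sigma>) (unfold \<Sigma> A) (unfold \<Sigma> B)"
    by auto
qed

section \<open>Soundness of algorithmic type equality\<close>

text \<open>With its variables bounded in this way, a closure read in
  \<open>\<tau> @ \<sigma>\<close> depends on \<open>\<tau>\<close> alone. Rule \<open>def\<close>
  needs this to separate the closure from the ambient context.\<close>

primrec closure_over :: "'v closure \<Rightarrow> bool" where
  "closure_over (Closure n C V es W es') \<longleftrightarrow>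
     prop_over n C \<and> (\<forall>e\<in>set es. exp_over n e) \<and> (\<forall>e\<in>set es'. exp_over n e)"

primrec closure_holds :: "('l, 'v) signature \<Rightarrow> nat \<Rightarrow> 'v closure \<Rightarrow> bool" where
  "closure_holds \<Sigma> k (Closure n C V es W es') \<longleftrightarrow>
     (\<forall>\<tau>. length \<tau> = n \<longrightarrow> sat \<tau> C \<longrightarrow>
        (subst_tp (Name V es) (ground \<tau>), subst_tp (Name W es') (ground \<tau>)) \<in> approx \<Sigma> k)"

lemma closure_holds_antimono: "j \<le> k \<Longrightarrow> closure_holds \<Sigma> k \<gamma> \<Longrightarrow> closure_holds \<Sigma> j \<gamma>"
  using approx_antimono[of j k \<Sigma>] by (cases \<gamma>) auto

lemma unfold_non_name: "\<nexists>V es. A = Name V es \<Longrightarrow> unfold \<Sigma> A = A"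
  by (auto simp: unfold_def split: tp.splits)

lemma subst_tp_non_name: "\<nexists>V es. A = Name V es \<Longrightarrow> \<nexists>V es. subst_tp A \<theta> = Name V es"
  by (cases A) auto

text \<open>The values in \<open>ground \<sigma>\<close> are constants, untouched by the shift under
  the binder, so the bound variable can be filled in afterwards.\<close>

lemma subst_ground_Cons:
  "subst_tp (subst_tp A (under_binder (ground \<sigma>))) (ground [i]) = subst_tp A (ground (i # \<sigma>))"
proof -
  have "subst_exp (ground [i]) (under_binder (ground \<sigma>) j) = ground (i # \<sigma>) j" for j
    by (cases j) (auto simp: ground_def inst_def)
  then show ?thesis by (simp add: subst_tp_subst)
qed

text \<open>The two lists may live in different contexts, that of a closure and the ambient one.
  Equal evaluation identifies their ground instances only up to \<open>val_exp\<close>.\<close>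

lemma val_exps_ground_eq:
  assumes "\<forall>e\<in>set es. exp_over (length \<sigma>) e" "\<forall>e\<in>set es'. exp_over (length \<tau>) e"
    "map (eval \<sigma>) es = map (eval \<tau>) es'"
  shows "map val_exp (map (subst_exp (ground \<sigma>)) es) = map val_exp (map (subst_exp (ground \<tau>)) es')"
proof -
  have val: "val_exp (subst_exp (ground \<sigma>) e) = Const (eval \<sigma> e)" if "exp_over (length \<sigma>) e" for e \<sigma>
  proof -
    have "exp_over 0 (subst_exp (ground \<sigma>) e)" using that by (rule exp_over_subst) (simp add: ground_nth)
    then show ?thesis using that by (simp add: val_exp_closed eval_ground)
  qed
  have "map (\<lambda>e. Const (eval \<sigma> e)) es = map (\<lambda>e. Const (eval \<tau> e)) es'"
    using arg_cong[OF assms(3), of "map Const"] by (simp add: comp_def)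
  moreover have "map (\<lambda>e. val_exp (subst_exp (ground \<sigma>) e)) es = map (\<lambda>e. Const (eval \<sigma> e)) es"
    "map (\<lambda>e. val_exp (subst_exp (ground \<tau>) e)) es' = map (\<lambda>e. Const (eval \<tau> e)) es'"
    using assms(1,2) val by auto
  ultimately show ?thesis by (simp add: comp_def)
qed

text \<open>The level \<open>k\<close> is quantified inside, so that \<open>expd\<close> can use the
  induction hypothesis for its body at every level in turn. The stronger conjunct excludes names
  because \<open>def\<close> gains no level.\<close>

definition sound :: "('l, 'v) signature \<Rightarrow> nat \<Rightarrow> aprop \<Rightarrow> 'v closure list \<Rightarrow>
    ('l, 'v) tp \<Rightarrow> ('l, 'v) tp \<Rightarrow> bool" where
  "sound \<Sigma> n C \<Gamma> A B \<longleftrightarrow> (\<forall>\<sigma> k. length \<sigma> = n \<longrightarrow> sat \<sigma> C \<longrightarrow> (\<forall>\<gamma>\<in>set \<Gamma>. closure_holds \<Sigma> k \<gamma>) \<longrightarrow>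
     (subst_tp A (ground \<sigma>), subst_tp B (ground \<sigma>)) \<in> approx \<Sigma> k \<and>
     ((\<nexists>V es. A = Name V es) \<longrightarrow> (\<nexists>V es. B = Name V es) \<longrightarrow>
        (subst_tp A (ground \<sigma>), subst_tp B (ground \<sigma>)) \<in> approx \<Sigma> (Suc k)))"

lemma soundD:
  assumes "sound \<Sigma> n C \<Gamma> A B" "length \<sigma> = n" "sat \<sigma> C" "\<forall>\<gamma>\<in>set \<Gamma>. closure_holds \<Sigma> k \<gamma>"
  shows "(subst_tp A (ground \<sigma>), subst_tp B (ground \<sigma>)) \<in> approx \<Sigma> k"
    "(\<nexists>V es. A = Name V es) \<Longrightarrow> (\<nexists>V es. B = Name V es) \<Longrightarrow>
      (subst_tp A (ground \<sigma>), subst_tp B (ground \<sigma>)) \<in> approx \<Sigma> (Suc k)"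
  using assms by (auto simp: sound_def simp del: approx.simps)

text \<open>Relating the components at level \<open>k\<close> is one step, hence level
  \<open>Suc k\<close> for the whole; the weaker conjunct follows since the approximations
  decrease.\<close>

lemma sound_structural:
  assumes "\<nexists>V es. A = Name V es" "\<nexists>V es. B = Name V es"
    and "\<And>\<sigma> k. length \<sigma> = n \<Longrightarrow> sat \<sigma> C \<Longrightarrow> \<forall>\<gamma>\<in>set \<Gamma>. closure_holds \<Sigma> k \<gamma> \<Longrightarrow>
      bisim_step (approx \<Sigma> k) (subst_tp A (ground \<sigma>)) (subst_tp B (ground \<sigma>))"
  shows "sound \<Sigma> n C \<Gamma> A B"
proof -
  have "(subst_tp A (ground \<sigma>), subst_tp B (ground \<sigma>)) \<in> approx \<Sigma> (Suc k)"
    if "length \<sigma> = n" "sat \<sigma> C" "\<forall>\<gamma>\<in>set \<Gamma>. closure_holds \<Sigma> k \<gamma>" for \<sigma> k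
    using assms(3)[OF that] assms(1,2) by (simp add: unfold_non_name subst_tp_non_name)
  then show ?thesis unfolding sound_def using approx_Suc_subset by blast
qed

lemma sound_name:
  assumes "\<And>\<sigma> k. length \<sigma> = n \<Longrightarrow> sat \<sigma> C \<Longrightarrow> \<forall>\<gamma>\<in>set \<Gamma>. closure_holds \<Sigma> k \<gamma> \<Longrightarrow>
      (subst_tp (Name V es) (ground \<sigma>), subst_tp (Name W es') (ground \<sigma>)) \<in> approx \<Sigma> k"
  shows "sound \<Sigma> n C \<Gamma> (Name V es) (Name W es')"
  using assms by (simp add: sound_def)

lemma tp_eq_sound:
  assumes sig: "valid_signature \<Sigma>"
  shows "tp_eq \<Sigma> n C \<Gamma> A B \<Longrightarrow> prop_over n C \<Longrightarrow> \<forall>\<gamma>\<in>set \<Gamma>. closure_over \<gamma>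
    \<Longrightarrow> valid_tp \<Sigma> n C A \<Longrightarrow> valid_tp \<Sigma> n C B \<Longrightarrow> sound \<Sigma> n C \<Gamma> A B"
proof (induction rule: tp_eq.induct)
  case (plus n C \<Gamma> f g)
  have rel: "fmrel (sound \<Sigma> n C \<Gamma>) f g"
    using plus by (auto elim!: fmap.rel_mono_strong valid_plusE simp: fmlookup_ran'_iff)
  show ?case
  proof (rule sound_structural)
    fix \<sigma> k assume "length \<sigma> = n" "sat \<sigma> C" "\<forall>\<gamma>\<in>set \<Gamma>. closure_holds \<Sigma> k \<gamma>"
    then show "bisim_step (approx \<Sigma> k) (subst_tp (Plus f) (ground \<sigma>)) (subst_tp (Plus g) (ground \<sigma>))"
      by (auto simp: fmap.rel_map intro: fmap.rel_mono_strong[OF rel] soundD)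
  qed auto
next
  case ("with" n C \<Gamma> f g)
  have rel: "fmrel (sound \<Sigma> n C \<Gamma>) f g"
    using "with" by (auto elim!: fmap.rel_mono_strong valid_withE simp: fmlookup_ran'_iff)
  show ?case
  proof (rule sound_structural)
    fix \<sigma> k assume "length \<sigma> = n" "sat \<sigma> C" "\<forall>\<gamma>\<in>set \<Gamma>. closure_holds \<Sigma> k \<gamma>"
    then show "bisim_step (approx \<Sigma> k) (subst_tp (With f) (ground \<sigma>)) (subst_tp (With g) (ground \<sigma>))"
      by (auto simp: fmap.rel_map intro: fmap.rel_mono_strong[OF rel] soundD)
  qed auto
next
  case (tensor n C \<Gamma> A\<^sub>1 B\<^sub>1 A\<^sub>2 B\<^sub>2)
  then have s: "sound \<Sigma> n C \<Gamma> A\<^sub>1 B\<^sub>1" "sound \<Sigma> n C \<Gamma> A\<^sub>2 B\<^sub>2"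
    by (auto elim!: valid_tensorE)
  show ?case
  proof (rule sound_structural)
    fix \<sigma> k assume *: "length \<sigma> = n" "sat \<sigma> C" "\<forall>\<gamma>\<in>set \<Gamma>. closure_holds \<Sigma> k \<gamma>"
    show "bisim_step (approx \<Sigma> k) (subst_tp (Tensor A\<^sub>1 A\<^sub>2) (ground \<sigma>)) (subst_tp (Tensor B\<^sub>1 B\<^sub>2) (ground \<sigma>))"
      using soundD(1)[OF s(1) *] soundD(1)[OF s(2) *] by simp
  qed auto
next
  case (lolli n C \<Gamma> A\<^sub>1 B\<^sub>1 A\<^sub>2 B\<^sub>2)
  then have s: "sound \<Sigma> n C \<Gamma> A\<^sub>1 B\<^sub>1" "sound \<Sigma> n C \<Gamma> A\<^sub>2 B\<^sub>2"
    by (auto elim!: valid_lolliE)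
  show ?case
  proof (rule sound_structural)
    fix \<sigma> k assume *: "length \<sigma> = n" "sat \<sigma> C" "\<forall>\<gamma>\<in>set \<Gamma>. closure_holds \<Sigma> k \<gamma>"
    show "bisim_step (approx \<Sigma> k) (subst_tp (Lolli A\<^sub>1 A\<^sub>2) (ground \<sigma>)) (subst_tp (Lolli B\<^sub>1 B\<^sub>2) (ground \<sigma>))"
      using soundD(1)[OF s(1) *] soundD(1)[OF s(2) *] by simp
  qed auto
next
  case (one n C \<Gamma>)
  then show ?case by (auto intro!: sound_structural)
next
  case (quest n C \<phi> \<psi> \<Gamma> A B)
  have over: "prop_over n \<phi>" "prop_over n \<psi>"
    and A: "valid_tp \<Sigma> n (Conj C \<phi>) A" and B: "valid_tp \<Sigma> n (Conj C \<psi>) B"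
    using quest.prems by (auto elim: valid_questE)
  have iff: "sat \<sigma> \<phi> = sat \<sigma> \<psi>" if "length \<sigma> = n" "sat \<sigma> C" for \<sigma>
    using quest.hyps(1) that by (auto simp: entails_def)
  \<comment> \<open>\<open>B\<close> is known to be valid under its own guard, but the premise
    compares the bodies under \<open>\<phi>\<close>; given \<open>C\<close>, the guards are
    equivalent.\<close>
  have "valid_tp \<Sigma> n (Conj C \<phi>) B"
    using quest.prems(1) over iff by (intro valid_weaken[OF sig B]) (auto simp: entails_def)
  with quest over A have s: "sound \<Sigma> n (Conj C \<phi>) \<Gamma> A B" by auto
  show ?case
  proof (rule sound_structural)
    fix \<sigma> k assume *: "length \<sigma> = n" "sat \<sigma> C" "\<forall>\<gamma>\<in>set \<Gamma>. closure_holds \<Sigma> k \<gamma>"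
    show "bisim_step (approx \<Sigma> k) (subst_tp (Quest \<phi> A) (ground \<sigma>)) (subst_tp (Quest \<psi> B) (ground \<sigma>))"
      \<comment> \<open>The truth of \<open>\<phi>\<close> under \<open>\<sigma>\<close> selects the
        disjunct. If it fails, so does the other guard, and the bodies need no comparison.\<close>
      using soundD(1)[OF s *(1) _ *(3)] iff[OF *(1,2)] over *(1,2)
      by (auto simp: true_prop_iff sat_ground)
  qed auto
next
  case (bang n C \<phi> \<psi> \<Gamma> A B)
  have over: "prop_over n \<phi>" "prop_over n \<psi>"
    and A: "valid_tp \<Sigma> n (Conj C \<phi>) A" and B: "valid_tp \<Sigma> n (Conj C \<psi>) B"
    using bang.prems by (auto elim: valid_bangE)
  have iff: "sat \<sigma> \<phi> = sat \<sigma> \<psi>" if "length \<sigma> = n" "sat \<sigma> C" for \<sigma>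
    using bang.hyps(1) that by (auto simp: entails_def)
  have "valid_tp \<Sigma> n (Conj C \<phi>) B"
    using bang.prems(1) over iff by (intro valid_weaken[OF sig B]) (auto simp: entails_def)
  with bang over A have s: "sound \<Sigma> n (Conj C \<phi>) \<Gamma> A B" by auto
  show ?case
  proof (rule sound_structural)
    fix \<sigma> k assume *: "length \<sigma> = n" "sat \<sigma> C" "\<forall>\<gamma>\<in>set \<Gamma>. closure_holds \<Sigma> k \<gamma>"
    show "bisim_step (approx \<Sigma> k) (subst_tp (Bang \<phi> A) (ground \<sigma>)) (subst_tp (Bang \<psi> B) (ground \<sigma>))"
      using soundD(1)[OF s *(1) _ *(3)] iff[OF *(1,2)] over *(1,2)
      by (auto simp: true_prop_iff sat_ground)
  qed auto
next
  case (ex n C \<Gamma> A B)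
  have s: "sound \<Sigma> (Suc n) (shift_prop 1 C) \<Gamma> A B"
    using ex prop_over_shift by (auto elim!: valid_exE)
  show ?case
  proof (rule sound_structural)
    fix \<sigma> k assume *: "length \<sigma> = n" "sat \<sigma> C" "\<forall>\<gamma>\<in>set \<Gamma>. closure_holds \<Sigma> k \<gamma>"
    have "(subst_tp A (ground (i # \<sigma>)), subst_tp B (ground (i # \<sigma>))) \<in> approx \<Sigma> k" for i
      using * sat_shift[OF ex.prems(1)] by (intro soundD(1)[OF s]) auto
    then show "bisim_step (approx \<Sigma> k) (subst_tp (TEx A) (ground \<sigma>)) (subst_tp (TEx B) (ground \<sigma>))"
      by (simp add: subst_ground_Cons)
  qed auto
next
  case (all n C \<Gamma> A B)
  have s: "sound \<Sigma> (Suc n) (shift_prop 1 C) \<Gamma> A B"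
    using all prop_over_shift by (auto elim!: valid_allE)
  show ?case
  proof (rule sound_structural)
    fix \<sigma> k assume *: "length \<sigma> = n" "sat \<sigma> C" "\<forall>\<gamma>\<in>set \<Gamma>. closure_holds \<Sigma> k \<gamma>"
    have "(subst_tp A (ground (i # \<sigma>)), subst_tp B (ground (i # \<sigma>))) \<in> approx \<Sigma> k" for i
      using * sat_shift[OF all.prems(1)] by (intro soundD(1)[OF s]) auto
    then show "bisim_step (approx \<Sigma> k) (subst_tp (TAll A) (ground \<sigma>)) (subst_tp (TAll B) (ground \<sigma>))"
      by (simp add: subst_ground_Cons)
  qed auto
next
  case (bot n C \<Gamma> A B)
  then show ?case by (auto simp: sound_def entails_def)
next
  case (refl es es' n C \<Gamma> V)
  show ?case
  proof (rule sound_name)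
    fix \<sigma> k assume \<sigma>: "length \<sigma> = n" "sat \<sigma> C"
    \<comment> \<open>The two names then have ground instances of equal value, so reflexivity of
      \<open>approx\<close> and \<open>approx_val\<close> suffice.\<close>
    have "map (eval \<sigma>) es' = map (eval \<sigma>) es"
      using refl.hyps \<sigma> by (auto simp: entails_def sat_all_eq)
    then have "map val_exp (map (subst_exp (ground \<sigma>)) es') = map val_exp (map (subst_exp (ground \<sigma>)) es)"
      using refl.prems \<sigma> by (intro val_exps_ground_eq) (auto elim: valid_nameE)
    then show "(subst_tp (Name V es) (ground \<sigma>), subst_tp (Name V es') (ground \<sigma>)) \<in> approx \<Sigma> k"
      by (intro approx_val[OF approx_refl[of "subst_tp (Name V es) (ground \<sigma>)"]]) auto
  qed
next
  case (expd V\<^sub>1 k\<^sub>1 \<phi>\<^sub>1 A es\<^sub>1 V\<^sub>2 k\<^sub>2 \<phi>\<^sub>2 B es\<^sub>2 n C \<Gamma>)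
  let ?\<gamma> = "Closure n C V\<^sub>1 es\<^sub>1 V\<^sub>2 es\<^sub>2"
  note D1 = valid_signatureD[OF sig expd.hyps(1)] and D2 = valid_signatureD[OF sig expd.hyps(3)]
  have "closure_over ?\<gamma>" using expd.prems by (auto elim!: valid_nameE)
  then have body: "sound \<Sigma> n C (?\<gamma> # \<Gamma>) (subst_tp A (inst es\<^sub>1)) (subst_tp B (inst es\<^sub>2))"
    using expd by (intro expd.IH) (auto intro: valid_body[OF sig])
  \<comment> \<open>By contractiveness an instance of the body is not a name and is its own
    unfolding. Hence names and bodies are related at the same positive levels.\<close>
  have unf: "unfold \<Sigma> (subst_tp (Name V\<^sub>1 es\<^sub>1) \<theta>) = unfold \<Sigma> (subst_tp (subst_tp A (inst es\<^sub>1)) \<theta>)"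
    "unfold \<Sigma> (subst_tp (Name V\<^sub>2 es\<^sub>2) \<theta>) = unfold \<Sigma> (subst_tp (subst_tp B (inst es\<^sub>2)) \<theta>)" for \<theta>
    using D1 D2 expd.hyps(2,4)
    by (auto simp: subst_body unfold_non_name subst_tp_non_name) (simp_all add: unfold_def)
  \<comment> \<open>This breaks the circle. At level 0 everything is related; at
    \<open>Suc j\<close>, the new closure at level \<open>j\<close> is a legitimate hypothesis for
    the bodies, whose conclusion is one level higher.\<close>
  have "closure_holds \<Sigma> j ?\<gamma>" if "\<forall>\<gamma>\<in>set \<Gamma>. closure_holds \<Sigma> j \<gamma>" for j
    using that
  proof (induction j)
    case (Suc j)
    then have \<Gamma>: "\<forall>\<gamma>\<in>set \<Gamma>. closure_holds \<Sigma> j \<gamma>" using closure_holds_antimono[of j "Suc j"] by auto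
    have "(subst_tp (subst_tp A (inst es\<^sub>1)) (ground \<tau>), subst_tp (subst_tp B (inst es\<^sub>2)) (ground \<tau>))
        \<in> approx \<Sigma> (Suc j)" if "length \<tau> = n" "sat \<tau> C" for \<tau>
      using \<Gamma> Suc.IH[OF \<Gamma>] that D1(2) D2(2)
      by (intro soundD(2)[OF body] subst_tp_non_name) auto
    then show ?case unfolding closure_holds.simps approx.simps mem_Collect_eq prod.case unf by blast
  qed simp
  then show ?case by (intro sound_name) auto
next
  case ("def" n' C' V\<^sub>1 es\<^sub>1' V\<^sub>2 es\<^sub>2' \<Gamma> es\<^sub>1 es\<^sub>2 n C)
  show ?case
  proof (rule sound_name)
    fix \<sigma> k assume \<sigma>: "length \<sigma> = n" "sat \<sigma> C" and \<Gamma>: "\<forall>\<gamma>\<in>set \<Gamma>. closure_holds \<Sigma> k \<gamma>"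
    have over: "prop_over n' C'" "\<forall>e\<in>set es\<^sub>1'. exp_over n' e" "\<forall>e\<in>set es\<^sub>2'. exp_over n' e"
      using "def.prems"(2) "def.hyps"(1) by auto
    have over': "\<forall>e\<in>set es\<^sub>1. exp_over n e" "\<forall>e\<in>set es\<^sub>2. exp_over n e"
      using "def.prems" by (auto elim: valid_nameE)
    \<comment> \<open>\<open>\<tau>\<close> gives the values of the closure's own variables, which
      sit below the ambient ones in the index order.\<close>
    obtain \<tau> where \<tau>: "length \<tau> = n'" "sat (\<tau> @ \<sigma>) C'"
      "map (eval (\<tau> @ \<sigma>)) es\<^sub>1' = map (eval (\<tau> @ \<sigma>)) (map (shift_exp n') es\<^sub>1)"
      "map (eval (\<tau> @ \<sigma>)) es\<^sub>2' = map (eval (\<tau> @ \<sigma>)) (map (shift_exp n') es\<^sub>2)"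
      using "def.hyps" \<sigma> by (auto simp: entails_def sat_exns sat_all_eq simp del: map_map)
    have left: "map (eval (\<tau> @ \<sigma>)) es = map (eval \<tau>) es" if "\<forall>e\<in>set es. exp_over n' e" for es
      using that \<tau>(1) by (auto intro: eval_append)
    have right: "map (eval (\<tau> @ \<sigma>)) (map (shift_exp n') es) = map (eval \<sigma>) es" for es
      using \<tau>(1) by (auto simp: eval_shift)
    have "map (eval \<sigma>) es\<^sub>1 = map (eval \<tau>) es\<^sub>1'" "map (eval \<sigma>) es\<^sub>2 = map (eval \<tau>) es\<^sub>2'"
      using \<tau>(3,4) unfolding right left[OF over(2)] left[OF over(3)] by simp_all
    then have "map val_exp (map (subst_exp (ground \<sigma>)) es\<^sub>1) = map val_exp (map (subst_exp (ground \<tau>)) es\<^sub>1')"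
      "map val_exp (map (subst_exp (ground \<sigma>)) es\<^sub>2) = map val_exp (map (subst_exp (ground \<tau>)) es\<^sub>2')"
      using over over' \<tau>(1) \<sigma>(1) by (intro val_exps_ground_eq; simp)+
    \<comment> \<open>The closure is used at the ground instance \<open>\<tau>\<close> and at the
      same level \<open>k\<close>.\<close>
    moreover have "(subst_tp (Name V\<^sub>1 es\<^sub>1') (ground \<tau>), subst_tp (Name V\<^sub>2 es\<^sub>2') (ground \<tau>)) \<in> approx \<Sigma> k"
      using \<Gamma> "def.hyps"(1) \<tau>(1,2) over(1) sat_append[of \<tau> C' \<sigma>] by fastforce
    ultimately show "(subst_tp (Name V\<^sub>1 es\<^sub>1) (ground \<sigma>), subst_tp (Name V\<^sub>2 es\<^sub>2) (ground \<sigma>)) \<in> approx \<Sigma> k"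
      by (elim approx_val) auto
  qed
qed

theorem theorem20:
  fixes \<Sigma> :: "('l, 'v) signature" and n :: nat and C :: aprop and A B :: "('l, 'v) tp"
  assumes "valid_signature \<Sigma>"
    and "prop_over n C"
    and "valid_tp \<Sigma> n C A"
    and "valid_tp \<Sigma> n C B"
    and "tp_eq \<Sigma> n C [] A B"
  shows "\<exists>R. type_bisimulation \<Sigma> R \<and>
    (\<forall>\<sigma>. length \<sigma> = n \<longrightarrow> true_prop (subst_prop (ground \<sigma>) C) \<longrightarrow>
       (subst_tp A (ground \<sigma>), subst_tp B (ground \<sigma>)) \<in> R)"
proof (intro exI conjI allI impI)
  show "type_bisimulation \<Sigma> (bisimilarity \<Sigma>)"
    using assms(1) by (rule type_bisimulation_bisimilarity)
  fix \<sigma> assume \<sigma>: "length \<sigma> = n" "true_prop (subst_prop (ground \<sigma>) C)"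
  then have "sat \<sigma> C" using assms(2) by (simp add: true_prop_iff sat_ground)
  \<comment> \<open>Without closures the hypothesis of \<open>sound\<close> is vacuous at every
    level, so the instances lie in all approximations.\<close>
  moreover have "sound \<Sigma> n C [] A B"
    using assms by (intro tp_eq_sound) auto
  ultimately show "(subst_tp A (ground \<sigma>), subst_tp B (ground \<sigma>)) \<in> bisimilarity \<Sigma>"
    using \<sigma>(1) valid_ground[OF assms(1) _ assms(2)] assms(3,4)
    by (auto simp: bisimilarity_def intro: soundD(1))
qed

end
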